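(* Let $d,n\ge 1$ be integers. There is a constant $C_3(d,n)>0$, which may depend on $d$ and $n$ but not on $\epsilon$, such that for every $\epsilon\in(0,1)$ and every function $f$ with $\|f\|_{W^{n,\infty}([0,1]^d)}\le 1$ there exists a bi-activation feed-forward network $M_{\mathcal C_F}$ with at most $\mathcal C_F=C_3(d,n)\,\epsilon^{-d/n}$ parameters $a\in\mathbb R^{\mathcal C_F}$ for which $$\min_{a\in\mathbb R^{\mathcal C_F}}\ \max_{x\in[0,1]^d}\ |f(x)-M_{\mathcal C_F}(a)(x)|\le\epsilon .$$
   Context: Sobolev norm: $\|f\|_{W^{n,\infty}([0,1]^d)}=\max_{\mathbf n:|\mathbf n|\le n}\operatorname{ess\,sup}_{x\in[0,1]^d}|D^{\mathbf n}f(x)|$, where $\mathbf n=(n_1,\dots,n_d)\in\{0,1,\dots\}^d$, $|\mathbf n|=\sum_{i=1}^d n_i$, and $D^{\mathbf n}f$ is the corresponding weak derivative. Since $n\ge1$, $f$ is identified with its continuous representative. Bi-activation feed-forward network: a function of the input $x$ computed by $h_0=x$, $h_{i+1}=\sigma_i(W_ih_i+b_i)$ for successive hidden layers $i$, followed by an affine output layer, where $W_i$ are (possibly sparse) weight matrices, $b_i$ are bias vectors, and each $\sigma_i$ acts coordinatewise and is either $\mathrm{ReLU}(t)=\max\{0,t\}$ or $t\mapsto t^2$, the choice depending on the layer. The network (number of layers, widths, which connections are present, and which activation is used in each layer) is a fixed architecture; its parameters $a$ are the weights of the connections that are present and the biases, and the number of parameters counts only these. $M(a)(x)$ denotes the output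 on input $x$ when the parameters are $a$. The bound "$\min_a\max_x\cdots\le\epsilon$" means that some choice of the parameters $a$ attains uniform error at most $\epsilon$. *)

theory Defs
  imports "HOL-Analysis.Analysis" "HOL-Probability.Essential_Supremum"
begin

section \<open>The Sobolev space of order \<open>n\<close> over the unit cube\<close>

text \<open>
  The type \<open>real ^ 'd\<close> has no order on its coordinates. We fix one enumeration of them; it
  determines the order of differentiation in \<open>multi_partial\<close> (irrelevant for smooth functions)
  and the numbering of the inputs of a network.
\<close>

definition coords :: "'d::finite list" where
  "coords = (SOME is. distinct is \<and> set is = UNIV)"

lemma coords: "distinct (coords :: 'd::finite list)" "set (coords :: 'd list) = UNIV"
  using someI_ex[of "\<lambda>is :: 'd list. distinct is \<and> set is = UNIV"]
    finite_distinct_list[of "UNIV :: 'd set"]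
  unfolding coords_def by auto

lemma length_coords: "length (coords :: 'd::finite list) = CARD('d)"
  by (metis coords distinct_card)

definition mi_order :: "nat ^ 'd \<Rightarrow> nat" where
  "mi_order \<alpha> = (\<Sum>i\<in>UNIV. \<alpha> $ i)"

lemma finite_mi_order_le: "finite {\<alpha> :: nat ^ 'd. mi_order \<alpha> \<le> n}"
proof (rule inj_on_finite)
  show "inj_on vec_nth {\<alpha> :: nat ^ 'd. mi_order \<alpha> \<le> n}"
    by (auto simp: inj_on_def vec_nth_inject)
  show "vec_nth ` {\<alpha> :: nat ^ 'd. mi_order \<alpha> \<le> n} \<subseteq> UNIV \<rightarrow>\<^sub>E {..n}"
  proof -
    have "\<alpha> $ i \<le> n" if "mi_order \<alpha> \<le> n" for \<alpha> :: "nat ^ 'd" and i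
    proof -
      have "\<alpha> $ i \<le> mi_order \<alpha>"
        unfolding mi_order_def by (rule member_le_sum) auto
      with that show ?thesis by simp
    qed
    then show ?thesis by auto
  qed
  show "finite ((UNIV :: 'd set) \<rightarrow>\<^sub>E {..n})"
    by (intro finite_PiE) auto
qed

definition partial_deriv :: "'d \<Rightarrow> (real ^ 'd \<Rightarrow> real) \<Rightarrow> real ^ 'd \<Rightarrow> real" where
  "partial_deriv i \<phi> x = frechet_derivative \<phi> (at x) (axis i 1)"

definition iter_partial :: "'d list \<Rightarrow> (real ^ 'd \<Rightarrow> real) \<Rightarrow> real ^ 'd \<Rightarrow> real" where
  "iter_partial is \<phi> = foldr partial_deriv is \<phi>"

definition multi_partial :: "nat ^ 'd \<Rightarrow> (real ^ 'd \<Rightarrow> real) \<Rightarrow> real ^ 'd \<Rightarrow> real" where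
  "multi_partial \<alpha> \<phi> = iter_partial (concat (map (\<lambda>i. replicate (\<alpha> $ i) i) coords)) \<phi>"

text \<open>Differentiability of all iterated partial derivatives makes them all continuous, so this
  is \<open>C\<^sup>\<infinity>\<close>.\<close>

definition smooth_fun :: "(real ^ 'd \<Rightarrow> real) \<Rightarrow> bool" where
  "smooth_fun \<phi> \<longleftrightarrow> (\<forall>is x. iter_partial is \<phi> differentiable (at x))"

definition test_fun :: "(real ^ 'd) set \<Rightarrow> (real ^ 'd \<Rightarrow> real) \<Rightarrow> bool" where
  "test_fun S \<phi> \<longleftrightarrow> smooth_fun \<phi> \<and> compact (closure {x. \<phi> x \<noteq> 0}) \<and> closure {x. \<phi> x \<noteq> 0} \<subseteq> S"

definition locally_integrable_on :: "(real ^ 'd \<Rightarrow> real) \<Rightarrow> (real ^ 'd) set \<Rightarrow> bool"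
  (infix "locally'_integrable'_on" 50) where
  "f locally_integrable_on S \<longleftrightarrow> (\<forall>K. compact K \<and> K \<subseteq> S \<longrightarrow> set_integrable lebesgue K f)"

definition has_weak_deriv ::
  "(real ^ 'd) set \<Rightarrow> nat ^ 'd \<Rightarrow> (real ^ 'd \<Rightarrow> real) \<Rightarrow> (real ^ 'd \<Rightarrow> real) \<Rightarrow> bool" where
  "has_weak_deriv S \<alpha> f g \<longleftrightarrow> f locally_integrable_on S \<and> g locally_integrable_on S \<and>
     (\<forall>\<phi>. test_fun S \<phi> \<longrightarrow>
        (LINT x:S|lebesgue. f x * multi_partial \<alpha> \<phi> x) =
        (-1) ^ mi_order \<alpha> * (LINT x:S|lebesgue. g x * \<phi> x))"

text \<open>Unique up to null sets where it exists; only its essential supremum is used.\<close>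

definition weak_deriv :: "nat ^ 'd \<Rightarrow> (real ^ 'd \<Rightarrow> real) \<Rightarrow> real ^ 'd \<Rightarrow> real" where
  "weak_deriv \<alpha> f = (SOME g. has_weak_deriv (box 0 1) \<alpha> f g)"

definition sobolev_space :: "nat \<Rightarrow> (real ^ 'd \<Rightarrow> real) set" where
  "sobolev_space n = {f. \<forall>\<alpha>. mi_order \<alpha> \<le> n \<longrightarrow>
     (\<exists>g. has_weak_deriv (box 0 1) \<alpha> f g \<and>
          esssup (lebesgue_on (cbox 0 1)) (\<lambda>x. ereal \<bar>g x\<bar>) < \<infinity>)}"

text \<open>Only meaningful for \<open>f \<in> sobolev_space n\<close>.\<close>

definition sobolev_norm :: "nat \<Rightarrow> (real ^ 'd \<Rightarrow> real) \<Rightarrow> ereal" where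
  "sobolev_norm n f =
     (MAX \<alpha>\<in>{\<alpha>. mi_order \<alpha> \<le> n}.
        esssup (lebesgue_on (cbox 0 1)) (\<lambda>x. ereal \<bar>weak_deriv \<alpha> f x\<bar>))"


section \<open>Bi-activation feed-forward networks\<close>

datatype activation = ReLU | Square

primrec act_fun :: "activation \<Rightarrow> real \<Rightarrow> real" where
  "act_fun ReLU t = max 0 t"
| "act_fun Square t = t\<^sup>2"

text \<open>
  Layer \<open>0\<close> is the input, layers \<open>1, \<dots>, num_hidden\<close> are hidden and layer \<open>num_hidden + 1\<close> is the
  output. Layer \<open>l + 1\<close> is obtained from layer \<open>l\<close> by the \<open>l\<close>-th affine map followed, if it is
  hidden, by the activation \<open>layer_act l\<close>. A triple \<open>(l, i, j)\<close> in \<open>conns\<close> says that unit \<open>j\<close> of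
  layer \<open>l\<close> is connected to unit \<open>i\<close> of layer \<open>l + 1\<close>.
\<close>

record architecture =
  num_hidden :: nat
  layer_width :: "nat \<Rightarrow> nat"
  layer_act :: "nat \<Rightarrow> activation"
  conns :: "(nat \<times> nat \<times> nat) set"

definition valid_architecture :: "nat \<Rightarrow> architecture \<Rightarrow> bool" where
  "valid_architecture d A \<longleftrightarrow>
     layer_width A 0 = d \<and>
     layer_width A (num_hidden A + 1) = 1 \<and>
     (\<forall>l \<le> num_hidden A + 1. layer_width A l > 0) \<and>
     conns A \<subseteq> {(l, i, j). l \<le> num_hidden A \<and> i < layer_width A (l + 1) \<and> j < layer_width A l}"

datatype param = Weight nat nat nat | Bias nat nat

definition params :: "architecture \<Rightarrow> param set" where
  "params A = {Weight l i j | l i j. (l, i, j) \<in> conns A} \<union>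
              {Bias l i | l i. l \<le> num_hidden A \<and> i < layer_width A (l + 1)}"

lemma finite_params:
  assumes "valid_architecture d A"
  shows "finite (params A)"
proof -
  let ?S = "SIGMA l:{..num_hidden A}. {..<layer_width A (l + 1)} \<times> {..<layer_width A l}"
  have "conns A \<subseteq> ?S"
    using assms by (auto simp: valid_architecture_def)
  then have "finite (conns A)"
    by (rule finite_subset) (intro finite_SigmaI finite_cartesian_product; simp)
  moreover have "params A = (\<lambda>(l, i, j). Weight l i j) ` conns A \<union>
      (\<lambda>(l, i). Bias l i) ` (SIGMA l:{..num_hidden A}. {..<layer_width A (l + 1)})"
    by (force simp: params_def)
  ultimately show ?thesis by simp
qed

definition weight_matrix :: "architecture \<Rightarrow> (param \<Rightarrow> real) \<Rightarrow> nat \<Rightarrow> nat \<Rightarrow> nat \<Rightarrow> real" where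
  "weight_matrix A a l i j = (if (l, i, j) \<in> conns A then a (Weight l i j) else 0)"

definition affine_map ::
  "architecture \<Rightarrow> (param \<Rightarrow> real) \<Rightarrow> nat \<Rightarrow> (nat \<Rightarrow> real) \<Rightarrow> nat \<Rightarrow> real" where
  "affine_map A a l h i = (\<Sum>j<layer_width A l. weight_matrix A a l i j * h j) + a (Bias l i)"

primrec layer_value ::
  "architecture \<Rightarrow> (param \<Rightarrow> real) \<Rightarrow> (nat \<Rightarrow> real) \<Rightarrow> nat \<Rightarrow> nat \<Rightarrow> real" where
  "layer_value A a h0 0 = h0"
| "layer_value A a h0 (Suc l) =
     (\<lambda>i. act_fun (layer_act A l) (affine_map A a l (layer_value A a h0 l) i))"

definition network :: "architecture \<Rightarrow> (param \<Rightarrow> real) \<Rightarrow> real ^ 'd \<Rightarrow> real" where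
  "network A a x =
     affine_map A a (num_hidden A)
       (layer_value A a (\<lambda>j. x $ (coords ! j)) (num_hidden A)) 0"

end

theory Submission
  imports Defs
begin

text \<open>
  Mollify \<open>f\<close>, after shrinking the cube slightly so that the mollifier stays inside: this
  gives a smooth function \<open>H\<close> uniformly close to \<open>f\<close> whose derivatives of order \<open>n\<close> are bounded by \<open>1\<close>,
  because they are integrals of weak derivatives of \<open>f\<close> against a probability density. No
  rate is needed here, since the network may depend on \<open>f\<close> in any way.

  On the grid of mesh \<open>1/N\<close> the Taylor polynomial of degree \<open>n - 1\<close> of \<open>H\<close> at a grid point has error at most
  \<open>(d/N)\<^sup>n\<close> on the neighbouring cells. Gluing these polynomials with the partition of unity made of
  products of hat functions gives a sum of \<open>O(N\<^sup>d)\<close> products of at most \<open>d + n\<close> functions that are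
  piecewise linear in one coordinate. One \<open>ReLU\<close> layer computes the factors, the squaring layers
  multiply them exactly by polarization, and \<open>N\<close> is of order \<open>\<epsilon> powr (- 1 / n)\<close>.
\<close>

section \<open>Networks as families of functions\<close>

text \<open>A unit is identified with the function of the input that it computes, so layers are sets of
  functions: \<open>U l\<close> is layer \<open>l\<close> after activation, and \<open>S l v \<subseteq> U l\<close> are the units feeding \<open>v \<in> U (l + 1)\<close>.
  Two networks are then put in parallel by taking unions.\<close>

definition wired :: "activation list \<Rightarrow> (nat \<Rightarrow> (real ^ 'd \<Rightarrow> real) set) \<Rightarrow>
    (nat \<Rightarrow> (real ^ 'd \<Rightarrow> real) \<Rightarrow> (real ^ 'd \<Rightarrow> real) set) \<Rightarrow>
    (nat \<Rightarrow> (real ^ 'd \<Rightarrow> real) \<Rightarrow> (real ^ 'd \<Rightarrow> real) \<Rightarrow> real) \<Rightarrow>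
    (nat \<Rightarrow> (real ^ 'd \<Rightarrow> real) \<Rightarrow> real) \<Rightarrow> bool" where
  "wired acts U S w b \<longleftrightarrow> U 0 = range (\<lambda>i x. x $ i) \<and>
     (\<forall>l<length acts. finite (U (Suc l)) \<and> U (Suc l) \<noteq> {} \<and>
        (\<forall>v\<in>U (Suc l). S l v \<subseteq> U l \<and>
           v = (\<lambda>x. act_fun (acts ! l) ((\<Sum>u\<in>S l v. w l v u * u x) + b l v))))"

text \<open>Each unit pays for its incoming weights and, through \<open>Suc\<close>, for its
  bias.\<close>

definition wiring_cost :: "nat \<Rightarrow> (nat \<Rightarrow> (real ^ 'd \<Rightarrow> real) set) \<Rightarrow>
    (nat \<Rightarrow> (real ^ 'd \<Rightarrow> real) \<Rightarrow> (real ^ 'd \<Rightarrow> real) set) \<Rightarrow> nat" where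
  "wiring_cost L U S = (\<Sum>l<L. \<Sum>v\<in>U (Suc l). Suc (card (S l v)))"

text \<open>The count \<open>p\<close> includes the output layer, which is affine and not listed in \<open>acts\<close>.\<close>

definition realizes :: "activation list \<Rightarrow> nat \<Rightarrow> (real ^ 'd \<Rightarrow> real) \<Rightarrow> bool" where
  "realizes acts p g \<longleftrightarrow> (\<exists>U S w b R c \<beta>. wired acts U S w b \<and> R \<subseteq> U (length acts) \<and>
     g = (\<lambda>x. (\<Sum>u\<in>R. c u * u x) + \<beta>) \<and> wiring_cost (length acts) U S + Suc (card R) \<le> p)"

lemma wiredD:
  assumes "wired acts U S w b"
  shows "U 0 = range (\<lambda>i x. x $ i)"
    and "l < length acts \<Longrightarrow> finite (U (Suc l))"
    and "l < length acts \<Longrightarrow> U (Suc l) \<noteq> {}"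
    and "l < length acts \<Longrightarrow> v \<in> U (Suc l) \<Longrightarrow> S l v \<subseteq> U l"
    and "l < length acts \<Longrightarrow> v \<in> U (Suc l) \<Longrightarrow>
      v = (\<lambda>x. act_fun (acts ! l) ((\<Sum>u\<in>S l v. w l v u * u x) + b l v))"
proof -
  note w = assms[unfolded wired_def]
  note w2 = w[THEN conjunct2, rule_format]
  show "U 0 = range (\<lambda>i x. x $ i)" by (rule conjunct1[OF w])
  assume l: "l < length acts"
  show "finite (U (Suc l))" "U (Suc l) \<noteq> {}"
    using w2[OF l] by (rule conjunct1, rule conjunct1[OF conjunct2])
  assume v: "v \<in> U (Suc l)"
  show "S l v \<subseteq> U l"
    by (rule w2[OF l, THEN conjunct2, THEN conjunct2, THEN bspec, OF v, THEN conjunct1])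
  show "v = (\<lambda>x. act_fun (acts ! l) ((\<Sum>u\<in>S l v. w l v u * u x) + b l v))"
    by (rule w2[OF l, THEN conjunct2, THEN conjunct2, THEN bspec, OF v, THEN conjunct2])
qed

lemma wired_finite:
  assumes "wired acts U S w b" "l \<le> length acts"
  shows "finite (U l)" "U l \<noteq> {}"
  using wiredD(1)[OF assms(1)] wiredD(2,3)[OF assms(1), of "l - 1"] assms(2)
  by (cases l; simp)+

text \<open>A function that is a unit of both networks is kept once, with its wiring from the first.
  A unit is nothing but the function it computes, so either wiring is correct, and costs are
  subadditive.\<close>

lemma wired_Un:
  assumes 1: "wired acts U S w b" and 2: "wired acts U' S' w' b'"
  obtains U'' S'' w'' b'' where "wired acts U'' S'' w'' b''" "\<And>l. U'' l = U l \<union> U' l"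
    "wiring_cost (length acts) U'' S'' \<le> wiring_cost (length acts) U S + wiring_cost (length acts) U' S'"
proof -
  define S'' where "S'' l v = (if v \<in> U (Suc l) then S l v else S' l v)" for l v
  define w'' where "w'' l v = (if v \<in> U (Suc l) then w l v else w' l v)" for l v
  define b'' where "b'' l v = (if v \<in> U (Suc l) then b l v else b' l v)" for l v
  have "wired acts (\<lambda>l. U l \<union> U' l) S'' w'' b''"
    unfolding wired_def
  proof (intro conjI allI impI ballI)
    show "U 0 \<union> U' 0 = range (\<lambda>i x. x $ i)"
      using wiredD(1)[OF 1] wiredD(1)[OF 2] by simp
  next
    fix l assume l: "l < length acts"
    show "finite (U (Suc l) \<union> U' (Suc l))" "U (Suc l) \<union> U' (Suc l) \<noteq> {}"
      using wiredD(2,3)[OF 1 l] wiredD(2,3)[OF 2 l] by simp_all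
    fix v assume v: "v \<in> U (Suc l) \<union> U' (Suc l)"
    show "S'' l v \<subseteq> U l \<union> U' l"
      using wiredD(4)[OF 1 l, of v] wiredD(4)[OF 2 l, of v] v by (auto simp: S''_def)
    show "v = (\<lambda>x. act_fun (acts ! l) ((\<Sum>u\<in>S'' l v. w'' l v u * u x) + b'' l v))"
    proof (cases "v \<in> U (Suc l)")
      case True
      then have "S'' l v = S l v" "w'' l v = w l v" "b'' l v = b l v"
        by (auto simp: S''_def w''_def b''_def)
      then show ?thesis using wiredD(5)[OF 1 l True] by presburger
    next
      case False
      then have "S'' l v = S' l v" "w'' l v = w' l v" "b'' l v = b' l v"
        by (auto simp: S''_def w''_def b''_def)
      moreover have "v \<in> U' (Suc l)" using False v by blast
      ultimately show ?thesis using wiredD(5)[OF 2 l] by presburger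
    qed
  qed
  moreover have "wiring_cost (length acts) (\<lambda>l. U l \<union> U' l) S''
      \<le> wiring_cost (length acts) U S + wiring_cost (length acts) U' S'"
    unfolding wiring_cost_def sum.distrib[symmetric]
  proof (rule sum_mono)
    fix l assume "l \<in> {..<length acts}"
    then have fin: "finite (U (Suc l))" "finite (U' (Suc l))" 
      using wiredD(2)[OF 1] wiredD(2)[OF 2] by auto
    have "(\<Sum>v\<in>U (Suc l) \<union> U' (Suc l). Suc (card (S'' l v)))
        = (\<Sum>v\<in>U (Suc l). Suc (card (S'' l v))) + (\<Sum>v\<in>U' (Suc l) - U (Suc l). Suc (card (S'' l v)))"
      using fin by (subst sum.union_disjoint[symmetric]) auto
    also have "(\<Sum>v\<in>U (Suc l). Suc (card (S'' l v))) = (\<Sum>v\<in>U (Suc l). Suc (card (S l v)))"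
      by (simp add: S''_def)
    also have "(\<Sum>v\<in>U' (Suc l) - U (Suc l). Suc (card (S'' l v)))
        = (\<Sum>v\<in>U' (Suc l) - U (Suc l). Suc (card (S' l v)))"
      by (rule sum.cong) (auto simp: S''_def)
    also have "\<dots> \<le> (\<Sum>v\<in>U' (Suc l). Suc (card (S' l v)))"
      using fin by (intro sum_mono2) auto
    finally show "(\<Sum>v\<in>U (Suc l) \<union> U' (Suc l). Suc (card (S'' l v)))
        \<le> (\<Sum>v\<in>U (Suc l). Suc (card (S l v))) + (\<Sum>v\<in>U' (Suc l). Suc (card (S' l v)))"
      by simp
  qed
  ultimately show ?thesis using that[of "\<lambda>l. U l \<union> U' l"] by blast
qed

section \<open>Closure properties of realizable functions\<close>

lemma realizes_mono: "realizes acts p g \<Longrightarrow> p \<le> q \<Longrightarrow> realizes acts q g"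
  unfolding realizes_def by (elim ex_forward conj_forward) simp_all

text \<open>Without hidden layers only the output unit pays: one weight and one bias.\<close>

lemma realizes_coord: "realizes [] 2 (\<lambda>x. x $ i)"
proof -
  have "wired [] (\<lambda>_. range (\<lambda>i x. x $ i)) undefined undefined undefined"
    by (simp add: wired_def)
  then show ?thesis
    unfolding realizes_def
    by (intro exI[of _ "\<lambda>_. range (\<lambda>i x. x $ i)"] exI[of _ undefined] exI[of _ "{\<lambda>x. x $ i}"]
          exI[of _ "\<lambda>_. 1"] exI[of _ 0]) (auto simp: wiring_cost_def)
qed

text \<open>The two output layers merge into one: a unit read by both receives the sum of its
  coefficients. Both networks must share the list of activations, so factors of different depth have
  to be brought to the same depth first.\<close>

lemma realizes_add:
  assumes "realizes acts p g" "realizes acts q h"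
  shows "realizes acts (p + q) (\<lambda>x. g x + h x)"
proof -
  obtain U S w b R c \<beta> where 1: "wired acts U S w b" "R \<subseteq> U (length acts)"
    "g = (\<lambda>x. (\<Sum>u\<in>R. c u * u x) + \<beta>)" "wiring_cost (length acts) U S + Suc (card R) \<le> p"
    using assms(1) unfolding realizes_def by blast
  obtain U' S' w' b' R' c' \<beta>' where 2: "wired acts U' S' w' b'" "R' \<subseteq> U' (length acts)"
    "h = (\<lambda>x. (\<Sum>u\<in>R'. c' u * u x) + \<beta>')" "wiring_cost (length acts) U' S' + Suc (card R') \<le> q"
    using assms(2) unfolding realizes_def by blast
  obtain U'' S'' w'' b'' where 3: "wired acts U'' S'' w'' b''" "\<And>l. U'' l = U l \<union> U' l"
    "wiring_cost (length acts) U'' S'' \<le> wiring_cost (length acts) U S + wiring_cost (length acts) U' S'"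
    using wired_Un[OF 1(1) 2(1)] by metis
  have fin: "finite R" "finite R'"
    using wired_finite(1)[OF 1(1) order_refl] wired_finite(1)[OF 2(1) order_refl] 1(2) 2(2)
    by (auto intro: finite_subset)
  define c'' where "c'' u = (if u \<in> R then c u else 0) + (if u \<in> R' then c' u else 0)" for u
  have "(\<Sum>u\<in>R. c u * u x) = (\<Sum>u\<in>R \<union> R'. (if u \<in> R then c u else 0) * u x)" for x
    using fin by (intro sum.mono_neutral_cong_left) auto
  moreover have "(\<Sum>u\<in>R'. c' u * u x) = (\<Sum>u\<in>R \<union> R'. (if u \<in> R' then c' u else 0) * u x)" for x
    using fin by (intro sum.mono_neutral_cong_left) auto
  ultimately have "(\<lambda>x. g x + h x) = (\<lambda>x. (\<Sum>u\<in>R \<union> R'. c'' u * u x) + (\<beta> + \<beta>'))"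
    by (simp add: 1(3) 2(3) c''_def sum.distrib algebra_simps fun_eq_iff)
  moreover have "card (R \<union> R') \<le> card R + card R'" by (rule card_Un_le)
  moreover have "R \<union> R' \<subseteq> U'' (length acts)" using 1(2) 2(2) 3(2) by auto
  ultimately show ?thesis
    unfolding realizes_def using 1(4) 2(4) 3(1) 3(3)
    by (intro exI[of _ U''] exI[of _ S''] exI[of _ w''] exI[of _ b''] exI[of _ "R \<union> R'"]
        exI[of _ c''] exI[of _ "\<beta> + \<beta>'"]) auto
qed

text \<open>The output layer is affine and absorbs the map at no cost.\<close>

lemma realizes_affine:
  assumes "realizes acts p g"
  shows "realizes acts p (\<lambda>x. r * g x + s)"
proof -
  obtain U S w b R c \<beta> where 1: "wired acts U S w b" "R \<subseteq> U (length acts)"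
    "g = (\<lambda>x. (\<Sum>u\<in>R. c u * u x) + \<beta>)" "wiring_cost (length acts) U S + Suc (card R) \<le> p"
    using assms(1) unfolding realizes_def by blast
  have "(\<lambda>x. r * g x + s) = (\<lambda>x. (\<Sum>u\<in>R. r * c u * u x) + (r * \<beta> + s))"
    by (simp add: 1(3) sum_distrib_left algebra_simps)
  with 1 show ?thesis
    unfolding realizes_def
    by (intro exI[of _ U] exI[of _ S] exI[of _ w] exI[of _ b] exI[of _ R]
        exI[of _ "\<lambda>u. r * c u"] exI[of _ "r * \<beta> + s"]) simp
qed

text \<open>The former output unit becomes the only unit of a new hidden layer; the \<open>2\<close>
  pays for the weight and bias of the new output unit.\<close>

lemma realizes_act:
  assumes "realizes acts p g"
  shows "realizes (acts @ [\<sigma>]) (p + 2) (\<lambda>x. act_fun \<sigma> (g x))"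
proof -
  obtain U S w b R c \<beta> where 1: "wired acts U S w b" "R \<subseteq> U (length acts)"
    "g = (\<lambda>x. (\<Sum>u\<in>R. c u * u x) + \<beta>)" "wiring_cost (length acts) U S + Suc (card R) \<le> p"
    using assms(1) unfolding realizes_def by blast
  define v where "v = (\<lambda>x. act_fun \<sigma> (g x))"
  let ?L = "length acts"
  let ?U = "U(Suc ?L := {v})" and ?S = "S(?L := (\<lambda>_. R))"
    and ?w = "w(?L := (\<lambda>_. c))" and ?b = "b(?L := (\<lambda>_. \<beta>))"
  have "wired (acts @ [\<sigma>]) ?U ?S ?w ?b"
    unfolding wired_def
  proof (intro conjI allI impI ballI)
    show "?U 0 = range (\<lambda>i x. x $ i)" using wiredD(1)[OF 1(1)] by simp
  next
    fix l assume l: "l < length (acts @ [\<sigma>])"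
    show "finite (?U (Suc l))" "?U (Suc l) \<noteq> {}"
      using l wiredD(2,3)[OF 1(1), of l] by auto
    fix u assume u: "u \<in> ?U (Suc l)"
    have "?S l u \<subseteq> ?U l \<and> u = (\<lambda>x. act_fun ((acts @ [\<sigma>]) ! l) ((\<Sum>t\<in>?S l u. ?w l u t * t x) + ?b l u))"
    proof (cases "l = ?L")
      case True
      then show ?thesis using u 1(2,3) by (auto simp: v_def)
    next
      case False
      then have l': "l < ?L" and u': "u \<in> U (Suc l)" using l u by auto
      have e: "?U l = U l" "?S l u = S l u" "?w l u = w l u" "?b l u = b l u"
         "(acts @ [\<sigma>]) ! l = acts ! l"
        using l' by (auto simp: nth_append)
      show ?thesis
        unfolding e using wiredD(4)[OF 1(1) l' u'] wiredD(5)[OF 1(1) l' u'] by blast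
    qed
    then show "?S l u \<subseteq> ?U l"
      "u = (\<lambda>x. act_fun ((acts @ [\<sigma>]) ! l) ((\<Sum>t\<in>?S l u. ?w l u t * t x) + ?b l u))"
      by blast+
  qed
  moreover have "wiring_cost (Suc ?L) (U(Suc ?L := {v})) (S(?L := (\<lambda>_. R)))
      = wiring_cost ?L U S + Suc (card R)"
    by (simp add: wiring_cost_def)
  ultimately show ?thesis
    unfolding realizes_def using 1(4)
    by (intro exI[of _ "U(Suc ?L := {v})"] exI[of _ "S(?L := (\<lambda>_. R))"] exI[of _ "w(?L := (\<lambda>_. c))"]
         exI[of _ "b(?L := (\<lambda>_. \<beta>))"] exI[of _ "{v}"] exI[of _ "\<lambda>_. 1"] exI[of _ 0])
       (auto simp: v_def)
qed

section \<open>From families of functions to architectures\<close>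

lemma layer_value_restrict:
  assumes "valid_architecture d A" "l \<le> num_hidden A" "i < layer_width A l"
  shows "layer_value A (restrict a (params A)) h l i = layer_value A a h l i"
  using assms(2,3)
proof (induction l arbitrary: i)
  case (Suc l)
  have "weight_matrix A (restrict a (params A)) l i j = weight_matrix A a l i j" for j
    by (auto simp: weight_matrix_def params_def)
  moreover have "restrict a (params A) (Bias l i) = a (Bias l i)"
    using Suc.prems by (auto simp: params_def)
  moreover have "layer_value A (restrict a (params A)) h l j = layer_value A a h l j"
    if "j < layer_width A l" for j
    by (rule Suc.IH) (use Suc.prems that in auto)
  ultimately show ?case by (simp add: affine_map_def del: restrict_apply)
qed simp

text \<open>The evaluation reads parameters only inside \<open>params A\<close>, so an assignment
  may be made extensional, as membership in \<open>params A \<rightarrow>\<^sub>E UNIV\<close>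
  demands.\<close>

lemma network_restrict:
  assumes "valid_architecture d A"
  shows "network A (restrict a (params A)) x = network A a x"
proof -
  have "weight_matrix A (restrict a (params A)) l i j = weight_matrix A a l i j" for l i j
    by (auto simp: weight_matrix_def params_def)
  moreover have "Bias (num_hidden A) 0 \<in> params A"
    using assms by (auto simp: params_def valid_architecture_def)
  ultimately show ?thesis
    using layer_value_restrict[OF assms order_refl]
    by (simp add: network_def affine_map_def)
qed

text \<open>Number the functions of each layer. The numberings are bijections, so they turn sums
  over feeding sets into sums over connections, and the wiring cost into the number of
  parameters.\<close>

lemma realizes_network:
  fixes g :: "real ^ 'd \<Rightarrow> real"
  assumes "realizes acts p g"
  obtains A a where "valid_architecture CARD('d) A" "card (params A) \<le> p"
    "a \<in> params A \<rightarrow>\<^sub>E UNIV" "\<And>x. network A a x = g x"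
proof -
  obtain U S w b R c \<beta> where 1: "wired acts U S w b" "R \<subseteq> U (length acts)"
    "g = (\<lambda>x. (\<Sum>u\<in>R. c u * u x) + \<beta>)" "wiring_cost (length acts) U S + Suc (card R) \<le> p"
    using assms(1) unfolding realizes_def by blast
  define L where "L = length acts"
  have fin: "finite (U l)" "U l \<noteq> {}" if "l \<le> L" for l
    using wired_finite[OF 1(1)] that by (auto simp: L_def)
  \<comment> \<open>Different coordinates are different functions, so identifying units with
    functions does not merge inputs.\<close>
  have inj0: "inj (\<lambda>i (x::real^'d). x $ i)"
  proof (rule injI)
    fix i j assume "(\<lambda>x::real^'d. x $ i) = (\<lambda>x. x $ j)"
    from fun_cong[OF this, of "axis i 1"] show "i = j"
      by (simp add: axis_def split: if_splits)
  qed
  have bij0: "bij_betw (\<lambda>j. coords ! j) {..<CARD('d)} (UNIV :: 'd set)"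
    using bij_betw_nth[OF coords(1)[where 'd = 'd], of "{..<CARD('d)}" UNIV]
    by (simp add: length_coords coords)
  have cU0: "card (U 0) = CARD('d)"
    using wiredD(1)[OF 1(1)] inj0 by (simp add: card_image)
  have "\<exists>e. bij_betw e {..<card (U l)} (U l)" if "l \<le> L" for l
    using ex_bij_betw_nat_finite[OF fin(1)[OF that]] by (auto simp: lessThan_atLeast0)
  then obtain e' where e': "\<And>l. l \<le> L \<Longrightarrow> bij_betw (e' l) {..<card (U l)} (U l)"
    by metis
  \<comment> \<open>Layer \<open>0\<close> must be numbered by \<open>coords\<close>, the order in
    which \<open>network\<close> feeds the inputs; the other layers may be numbered
    arbitrarily.\<close>
  define e where "e l j = (if l = 0 then (\<lambda>x. x $ (coords ! j)) else e' l j)" for l j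
  have e: "bij_betw (e l) {..<card (U l)} (U l)" if "l \<le> L" for l
  proof (cases "l = 0")
    case True
    have "bij_betw (\<lambda>i (x::real^'d). x $ i) UNIV (U 0)"
      using inj0 wiredD(1)[OF 1(1)] by (simp add: bij_betw_def)
    from bij_betw_trans[OF bij0 this] have "bij_betw (e 0) {..<CARD('d)} (U 0)"
      by (simp add: e_def[abs_def] o_def)
    then show ?thesis using True cU0 by simp
  next
    case False
    then have "e l = e' l" by (simp add: e_def fun_eq_iff)
    then show ?thesis using e'[OF that] by simp
  qed
  \<comment> \<open>\<open>T l i\<close> is the set of functions feeding unit \<open>i\<close> of
    layer \<open>l + 1\<close>; at \<open>l = L\<close> that unit is the output, which reads
    \<open>R\<close>.\<close>
  define T where "T l i = (if l < L then S l (e (Suc l) i) else R)" for l i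
  define W where "W l = (if l \<le> L then card (U l) else 1)" for l
  define N where "N l i = {j. j < W l \<and> e l j \<in> T l i}" for l i
  define A where "A = \<lparr>num_hidden = L, layer_width = W, layer_act = (\<lambda>l. acts ! l),
     conns = (SIGMA l:{..L}. SIGMA i:{..<W (Suc l)}. N l i)\<rparr>"
  define a where "a = (\<lambda>q. case q of
      Weight l i j \<Rightarrow> (if l < L then w l (e (Suc l) i) (e l j) else c (e l j))
    | Bias l i \<Rightarrow> (if l < L then b l (e (Suc l) i) else \<beta>))"
  have A: "num_hidden A = L" "layer_width A = W" "layer_act A = (\<lambda>l. acts ! l)"
     "conns A = (SIGMA l:{..L}. SIGMA i:{..<W (Suc l)}. N l i)"
    by (auto simp: A_def)
  \<comment> \<open>This positivity is why \<open>wired\<close> asks for nonempty layers.\<close>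
  have Wpos: "W l > 0" for l
    using fin by (auto simp: W_def card_gt_0_iff)
  have valid: "valid_architecture CARD('d) A"
    unfolding valid_architecture_def A using Wpos cU0 by (auto simp: W_def N_def)
  have TU: "T l i \<subseteq> U l" if "l \<le> L" "i < W (Suc l)" for l i
  proof (cases "l < L")
    case True
    then have "e (Suc l) i \<in> U (Suc l)"
      using e[of "Suc l"] that by (auto simp: bij_betw_def W_def)
    then show ?thesis using True wiredD(4)[OF 1(1)] by (auto simp: T_def L_def)
  next
    case False
    then show ?thesis using that 1(2) by (auto simp: T_def L_def)
  qed
  have bijN: "bij_betw (e l) (N l i) (T l i)" if "l \<le> L" "i < W (Suc l)" for l i
    unfolding bij_betw_def
  proof
    have ee: "inj_on (e l) {..<card (U l)}" "e l ` {..<card (U l)} = U l"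
      using e[OF that(1)] by (auto simp: bij_betw_def)
    show "inj_on (e l) (N l i)"
      using ee(1) by (rule inj_on_subset) (use that in \<open>auto simp: N_def W_def\<close>)
    show "e l ` N l i = T l i"
      using ee(2) TU[OF that] that(1) by (force simp: N_def W_def)
  qed
  have cardp: "card (params A) \<le> p"
  proof -
    let ?B = "SIGMA l:{..L}. {..<W (Suc l)}"
    have "params A = (\<lambda>(l, i, j). Weight l i j) ` conns A \<union> (\<lambda>(l, i). Bias l i) ` ?B"
      by (force simp: params_def A)
    also have "card \<dots> \<le> card (conns A) + card ?B"
      by (intro card_Un_le[THEN order_trans] add_mono card_image_le)
         (use A in \<open>auto intro!: finite_SigmaI simp: N_def\<close>)
    also have "card (conns A) = (\<Sum>l\<le>L. \<Sum>i<W (Suc l). card (N l i))"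
      unfolding A by (subst card_SigmaI; auto intro!: finite_SigmaI sum.cong simp: N_def)
    also have "card ?B = (\<Sum>l\<le>L. W (Suc l))"
      by (subst card_SigmaI) auto
    also have "(\<Sum>l\<le>L. \<Sum>i<W (Suc l). card (N l i)) + (\<Sum>l\<le>L. W (Suc l))
       = (\<Sum>l\<le>L. \<Sum>i<W (Suc l). Suc (card (N l i)))"
      by (simp add: sum.distrib[symmetric] sum_Suc)
    also have "\<dots> = (\<Sum>l\<le>L. \<Sum>i<W (Suc l). Suc (card (T l i)))"
      by (intro sum.cong refl) (simp add: bij_betw_same_card[OF bijN])
    also have "\<dots> = (\<Sum>l<L. \<Sum>i<W (Suc l). Suc (card (T l i))) + Suc (card R)"
      by (simp add: lessThan_Suc_atMost[symmetric] T_def W_def)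
    also have "(\<Sum>l<L. \<Sum>i<W (Suc l). Suc (card (T l i))) = wiring_cost L U S"
      unfolding wiring_cost_def
    proof (rule sum.cong[OF refl])
      fix l assume "l \<in> {..<L}"
      then show "(\<Sum>i<W (Suc l). Suc (card (T l i))) = (\<Sum>v\<in>U (Suc l). Suc (card (S l v)))"
        using sum.reindex_bij_betw[OF e[of "Suc l"], of "\<lambda>v. Suc (card (S l v))"]
        by (auto simp: T_def W_def)
    qed
    finally show ?thesis using 1(4) by (simp add: L_def)
  qed
  have aff: "affine_map A a l h i = (\<Sum>u\<in>T l i. (if l < L then w l (e (Suc l) i) u else c u) * u x)
        + (if l < L then b l (e (Suc l) i) else \<beta>)"
    if li: "l \<le> L" "i < W (Suc l)" and h: "\<And>j. j < W l \<Longrightarrow> h j = e l j x" for l i h x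
  proof -
    have "(\<Sum>j<W l. weight_matrix A a l i j * h j)
       = (\<Sum>j\<in>N l i. (if l < L then w l (e (Suc l) i) (e l j) else c (e l j)) * e l j x)"
      using li h by (intro sum.mono_neutral_cong_right)
        (auto simp: N_def weight_matrix_def A a_def)
    also have "\<dots> = (\<Sum>u\<in>T l i. (if l < L then w l (e (Suc l) i) u else c u) * u x)"
      by (rule sum.reindex_bij_betw[OF bijN[OF li]])
    finally show ?thesis by (simp add: affine_map_def A a_def)
  qed
  have lv: "layer_value A a (\<lambda>j. x $ (coords ! j)) l i = e l i x"
    if "l \<le> L" "i < W l" for x l i
    using that
  proof (induction l arbitrary: i)
    case 0
    then show ?case by (simp add: e_def)
  next
    case (Suc l)
    have "e (Suc l) i \<in> U (Suc l)"
      using e[of "Suc l"] Suc.prems by (auto simp: bij_betw_def W_def)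
    then have "e (Suc l) i = (\<lambda>x. act_fun (acts ! l)
       ((\<Sum>u\<in>S l (e (Suc l) i). w l (e (Suc l) i) u * u x) + b l (e (Suc l) i)))"
      using Suc.prems by (intro wiredD(5)[OF 1(1)]) (auto simp: L_def)
    from fun_cong[OF this, of x] show ?case
      using Suc aff[of l i "layer_value A a (\<lambda>j. x $ (coords ! j)) l" x] by (simp add: A T_def)
  qed
  have net: "network A a x = g x" for x
    using aff[of L 0 "layer_value A a (\<lambda>j. x $ (coords ! j)) L" x] lv Wpos
    by (simp add: network_def A 1(3) T_def)
  show ?thesis
  proof (rule that[OF valid cardp])
    show "restrict a (params A) \<in> params A \<rightarrow>\<^sub>E UNIV" by simp
    show "network A (restrict a (params A)) x = g x" for x
      using network_restrict[OF valid, of a x] net[of x] by (simp del: restrict_apply)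
  qed
qed

section \<open>Sums and exact products\<close>

lemma realizes_sum:
  assumes "finite I" "I \<noteq> {}" "\<And>i. i \<in> I \<Longrightarrow> realizes acts p (g i)"
  shows "realizes acts (card I * p) (\<lambda>x. \<Sum>i\<in>I. g i x)"
  using assms
proof (induction I rule: finite_ne_induct)
  case (insert i I)
  then have "realizes acts (p + card I * p) (\<lambda>x. g i x + (\<Sum>i\<in>I. g i x))"
    by (intro realizes_add) auto
  with insert.hyps show ?case by simp
qed simp

text \<open>\<open>g h = ((g + h)\<^sup>2 - (g - h)\<^sup>2) / 4\<close>\<close>

lemma realizes_mult:
  assumes g: "realizes acts p g" and h: "realizes acts q h"
  shows "realizes (acts @ [Square]) (2 * (p + q) + 4) (\<lambda>x. g x * h x)"
proof -
  have "realizes (acts @ [Square]) ((p + q + 2) + (p + q + 2))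
     (\<lambda>x. (1/4 * act_fun Square (g x + h x) + 0) + (- 1/4 * act_fun Square (g x + (- 1 * h x + 0)) + 0))"
    by (intro realizes_add realizes_affine realizes_act assms)
  moreover have "(\<lambda>x. (1/4 * act_fun Square (g x + h x) + 0) +
      (- 1/4 * act_fun Square (g x + (- 1 * h x + 0)) + 0)) = (\<lambda>x. g x * h x)"
    by (simp add: fun_eq_iff power2_eq_square field_simps)
  moreover have "(p + q + 2) + (p + q + 2) = 2 * (p + q) + 4" by simp
  ultimately show ?thesis by metis
qed

text \<open>\<open>t = ((t + 1)\<^sup>2 - (t - 1)\<^sup>2) / 4\<close> carries a value unchanged through a squaring layer.\<close>

lemma realizes_pass:
  assumes "realizes acts p g"
  shows "realizes (acts @ replicate k Square) (4 ^ k * (p + 4)) g"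
proof (induction k)
  case 0
  show ?case using realizes_mono[OF assms] by simp
next
  case (Suc k)
  let ?acts = "acts @ replicate k Square" and ?p = "4 ^ k * (p + 4)"
  have "realizes (?acts @ [Square]) ((?p + 2) + (?p + 2))
     (\<lambda>x. (1/4 * act_fun Square (1 * g x + 1) + 0) + (- 1/4 * act_fun Square (1 * g x + (-1)) + 0))"
    by (intro realizes_add realizes_affine realizes_act Suc)
  moreover have "(\<lambda>x. (1/4 * act_fun Square (1 * g x + 1) + 0) +
      (- 1/4 * act_fun Square (1 * g x + (-1)) + 0)) = g"
    by (simp add: fun_eq_iff power2_eq_square field_simps)
  ultimately have 1: "realizes (?acts @ [Square]) ((?p + 2) + (?p + 2)) g" by simp
  have "1 * 4 \<le> ?p" by (intro mult_le_mono) auto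
  moreover have "4 ^ Suc k * (p + 4) = 4 * ?p" by (simp only: power_Suc mult.assoc)
  ultimately have 2: "(?p + 2) + (?p + 2) \<le> 4 ^ Suc k * (p + 4)" by linarith
  have 3: "acts @ replicate (Suc k) Square = ?acts @ [Square]"
    by (simp add: replicate_append_same)
  show ?case unfolding 3 by (rule realizes_mono[OF 1 2])
qed

text \<open>The point is that \<open>P\<close> does not depend on the functions multiplied. By
  induction the head is carried through \<open>k\<close> squaring layers and then multiplied with
  the product of the tail in one more.\<close>

lemma realizes_prod_list:
  obtains P where "\<And>gs :: (real ^ 'd \<Rightarrow> real) list. length gs \<le> k \<Longrightarrow> (\<And>g. g \<in> set gs \<Longrightarrow> realizes acts p g) \<Longrightarrow>
     realizes (acts @ replicate k Square) P (\<lambda>x. prod_list (map (\<lambda>g. g x) gs))"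
proof -
  have "\<exists>P. \<forall>gs :: (real ^ 'd \<Rightarrow> real) list. length gs \<le> k \<longrightarrow> (\<forall>g\<in>set gs. realizes acts p g) \<longrightarrow>
     realizes (acts @ replicate k Square) P (\<lambda>x. prod_list (map (\<lambda>g. g x) gs))"
  proof (induction k)
    case 0
    \<comment> \<open>The empty product: a zero coefficient and bias \<open>1\<close> in the output
      layer give the constant over any list of activations.\<close>
    obtain q where "realizes acts q (\<lambda>x :: real ^ 'd. 1)"
    proof -
      have "\<exists>q. realizes acts q (\<lambda>x :: real ^ 'd. 1)"
      proof (induction acts rule: rev_induct)
        case Nil
        show ?case using realizes_affine[OF realizes_coord, of 0 undefined 1] by auto
      next
        case (snoc \<sigma> acts)
        then obtain q where "realizes acts q (\<lambda>x :: real ^ 'd. 1)" by blast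
        from realizes_affine[OF realizes_act[OF this, of \<sigma>], of 0 1] show ?case by auto
      qed
      then show ?thesis using that by blast
    qed
    then show ?case by auto
  next
    case (Suc k)
    then obtain P where P: "\<And>gs :: (real ^ 'd \<Rightarrow> real) list. length gs \<le> k \<Longrightarrow> (\<And>g. g \<in> set gs \<Longrightarrow> realizes acts p g) \<Longrightarrow>
     realizes (acts @ replicate k Square) P (\<lambda>x. prod_list (map (\<lambda>g. g x) gs))" by blast
    let ?q = "4 ^ k * (p + 4)"
    \<comment> \<open>The count adds the costs of both cases: a multiplication for a nonempty list,
      and one passing layer for the empty one.\<close>
    have "realizes (acts @ replicate (Suc k) Square) (2 * (?q + P) + 4 + 4 * (P + 4)) (\<lambda>x. prod_list (map (\<lambda>g. g x) gs))"
      if "length gs \<le> Suc k" "\<forall>g\<in>set gs. realizes acts p g" for gs :: "(real ^ 'd \<Rightarrow> real) list"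
    proof (cases gs)
      case Nil
      have "realizes (acts @ replicate k Square) P (\<lambda>x :: real ^ 'd. prod_list (map (\<lambda>g. g x) []))"
        using P[of "[]"] by simp
      from realizes_pass[OF this, of 1] Nil show ?thesis
        by (simp add: replicate_append_same[symmetric] realizes_mono)
    next
      case (Cons h hs)
      have "realizes (acts @ replicate k Square) P (\<lambda>x. prod_list (map (\<lambda>g. g x) hs))"
        using Cons that by (intro P) auto
      moreover have "realizes (acts @ replicate k Square) ?q h"
        using Cons that by (intro realizes_pass) auto
      ultimately have "realizes ((acts @ replicate k Square) @ [Square]) (2 * (?q + P) + 4)
          (\<lambda>x. h x * prod_list (map (\<lambda>g. g x) hs))"
        by (intro realizes_mult)
      with Cons show ?thesis
        by (simp add: replicate_append_same[symmetric] realizes_mono)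
    qed
    then show ?case by blast
  qed
  with that show ?thesis by blast
qed

section \<open>A smooth bump function\<close>

text \<open>The functions \<open>p(1/t) exp(-1/t)\<close>, extended by zero, form a class closed
  under differentiation.\<close>

definition flat :: "real poly \<Rightarrow> real \<Rightarrow> real" where
  "flat p t = (if t \<le> 0 then 0 else poly p (1 / t) * exp (- (1 / t)))"

lemma flat_minus: "flat (- p) t = - flat p t"
  by (simp add: flat_def)

lemma poly_exp_tendsto_0: "((\<lambda>s. poly q s * exp (- s)) \<longlongrightarrow> (0::real)) at_top"
proof -
  have "((\<lambda>s. \<Sum>i\<le>degree q. coeff q i * (s ^ i / exp s)) \<longlongrightarrow> (\<Sum>i\<le>degree q. coeff q i * 0)) at_top"
    by (intro tendsto_intros tendsto_power_div_exp_0)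
  then show ?thesis
    by (simp add: poly_altdef sum_distrib_right sum_divide_distrib exp_minus field_simps)
qed

text \<open>With \<open>s = 1/t\<close>, the derivative of \<open>p(s) exp(-s)\<close> in
  \<open>t\<close> is \<open>s^2 (p(s) - p'(s)) exp(-s)\<close>, and \<open>[:0, 0, 1:]\<close> is
  the factor \<open>s^2\<close>. At \<open>0\<close> the exponential beats every polynomial.\<close>

lemma flat_has_derivative:
  "(flat p has_real_derivative flat ([:0, 0, 1:] * (p - pderiv p)) t) (at t)"
proof -
  consider "t < 0" | "t = 0" | "t > 0" by linarith
  then show ?thesis
  proof cases
    case 1
    have "((\<lambda>_. 0) has_real_derivative 0) (at t)" by simp
    then have "(flat p has_real_derivative 0) (at t)"
      by (rule DERIV_cong_ev[THEN iffD1, rotated -1])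
         (use 1 in \<open>auto simp: flat_def eventually_nhds intro!: exI[of _ "{..<0}"]\<close>)
    then show ?thesis using 1 by (simp add: flat_def)
  next
    case 2
    have "((\<lambda>h. flat p h / h) \<longlongrightarrow> 0) (at_right 0)"
    proof (rule Lim_transform_eventually)
      \<comment> \<open>The difference quotient at \<open>h = 1/s\<close> is
        \<open>s p(s) exp(-s)\<close>; \<open>pCons 0\<close> multiplies by
        \<open>s\<close>.\<close>
      show "((\<lambda>h. poly (pCons 0 p) (inverse h) * exp (- inverse h)) \<longlongrightarrow> (0::real)) (at_right 0)"
        by (rule filterlim_compose[OF poly_exp_tendsto_0 filterlim_inverse_at_top_right])
      show "\<forall>\<^sub>F h in at_right 0. poly (pCons 0 p) (inverse h) * exp (- inverse h) = flat p h / h"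
        by (auto simp: eventually_at_right_field flat_def divide_inverse intro: exI[of _ 1])
    qed
    moreover have "((\<lambda>h. flat p h / h) \<longlongrightarrow> 0) (at_left 0)"
      by (rule tendsto_eventually) (auto simp: eventually_at_left_field flat_def intro: exI[of _ "-1"])
    ultimately have "((\<lambda>h. flat p h / h) \<longlongrightarrow> 0) (at 0)"
      by (simp add: filterlim_at_split)
    then show ?thesis using 2 by (simp add: has_field_derivative_def DERIV_def[unfolded has_field_derivative_def] flat_def)
  next
    case 3
    have "((\<lambda>t. poly p (1 / t) * exp (- (1 / t))) has_real_derivative
        (poly (pderiv p) (1 / t) * (- 1 / t^2)) * exp (- (1 / t)) + (exp (- (1 / t)) * (1 / t^2)) * poly p (1 / t)) (at t)"
      by (rule DERIV_mult; (rule DERIV_chain2[OF poly_DERIV])?)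
         (use 3 in \<open>auto intro!: derivative_eq_intros simp: power2_eq_square field_simps\<close>)
    then have "(flat p has_real_derivative
        (poly (pderiv p) (1 / t) * (- 1 / t^2)) * exp (- (1 / t)) + (exp (- (1 / t)) * (1 / t^2)) * poly p (1 / t)) (at t)"
      by (rule DERIV_cong_ev[THEN iffD1, rotated -1])
         (use 3 in \<open>auto simp: flat_def eventually_nhds intro!: exI[of _ "{0<..}"]\<close>)
    moreover have "flat ([:0, 0, 1:] * (p - pderiv p)) t = 
        (poly (pderiv p) (1 / t) * (- 1 / t^2)) * exp (- (1 / t)) + (exp (- (1 / t)) * (1 / t^2)) * poly p (1 / t)"
      using 3 by (simp add: flat_def power2_eq_square field_simps)
    ultimately show ?thesis by simp
  qed
qed

text \<open>The sums of these products are closed under differentiation, which yields smoothness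
  without a Leibniz formula for higher derivatives.\<close>

inductive bump_span :: "real \<Rightarrow> (real \<Rightarrow> real) \<Rightarrow> bool" for \<delta> where
  base: "bump_span \<delta> (\<lambda>t. flat p t * flat q (\<delta> - t))"
| add: "bump_span \<delta> f \<Longrightarrow> bump_span \<delta> g \<Longrightarrow> bump_span \<delta> (\<lambda>t. f t + g t)"

lemma bump_span_derivative:
  assumes "bump_span \<delta> f"
  shows "\<exists>f'. bump_span \<delta> f' \<and> (\<forall>t. (f has_real_derivative f' t) (at t))"
  using assms
proof induction
  case (base p q)
  let ?D = "\<lambda>p. [:0, 0, 1:] * (p - pderiv p)"
  \<comment> \<open>The inner derivative \<open>-1\<close> of \<open>\<delta> - t\<close> moves into
    the polynomial, so both terms of the product rule are again generators.\<close>
  have "((\<lambda>t. flat p t * flat q (\<delta> - t)) has_real_derivative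
      flat (?D p) t * flat q (\<delta> - t) + flat p t * flat (- ?D q) (\<delta> - t)) (at t)" for t
  proof -
    have "((\<lambda>t. flat q (\<delta> - t)) has_real_derivative flat (?D q) (\<delta> - t) * - 1) (at t)"
      by (rule DERIV_chain2[OF flat_has_derivative]) (auto intro!: derivative_eq_intros)
    from DERIV_mult[OF flat_has_derivative[of p] this] show ?thesis
      by (rule DERIV_cong) (simp only: flat_minus, simp)
  qed
  then show ?case
    by (intro exI[of _ "\<lambda>t. flat (?D p) t * flat q (\<delta> - t) + flat p t * flat (- ?D q) (\<delta> - t)"])
       (auto intro: bump_span.intros)
next
  case (add f g)
  then obtain f' g' where "bump_span \<delta> f'" "bump_span \<delta> g'"
    "\<And>t. (f has_real_derivative f' t) (at t)" "\<And>t. (g has_real_derivative g' t) (at t)" by blast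
  then show ?case
    by (intro exI[of _ "\<lambda>t. f' t + g' t"]) (auto intro: bump_span.add DERIV_add)
qed

text \<open>The bump is \<open>exp(-1/t) exp(-1/(\<delta> - t))\<close> on the interval from
  \<open>0\<close> to \<open>\<delta>\<close>. It comes with the sequence of all its derivatives, so
  that higher derivatives become an index.\<close>

lemma bump_chain:
  obtains \<rho> :: "nat \<Rightarrow> real \<Rightarrow> real"
  where "\<And>k t. (\<rho> k has_real_derivative \<rho> (Suc k) t) (at t)"
    "\<And>t. \<rho> 0 t \<ge> 0" "\<And>t. \<rho> 0 t \<noteq> 0 \<longleftrightarrow> 0 < t \<and> t < \<delta>"
proof -
  obtain D where D: "\<And>f. bump_span \<delta> f \<Longrightarrow> bump_span \<delta> (D f)"
    "\<And>f t. bump_span \<delta> f \<Longrightarrow> (f has_real_derivative D f t) (at t)"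
    using bump_span_derivative[of \<delta>] by metis
  define \<rho> where "\<rho> k = (D ^^ k) (\<lambda>t. flat [:1:] t * flat [:1:] (\<delta> - t))" for k
  have \<rho>: "bump_span \<delta> (\<rho> k)" for k
    by (induction k) (auto simp: \<rho>_def intro: bump_span.base D)
  have "(\<rho> k has_real_derivative \<rho> (Suc k) t) (at t)" for k t
    using D(2)[OF \<rho>[of k]] by (simp add: \<rho>_def)
  then show ?thesis
    by (rule that) (auto simp: \<rho>_def flat_def)
qed

section \<open>Mollification\<close>

lemma finite_lists_length: "finite {xs :: 'a::finite list. length xs = k}"
  using finite_lists_length_eq[of "UNIV :: 'a set" k] by simp

lemma card_lists_length: "card {xs :: 'a::finite list. length xs = k} = CARD('a) ^ k"
  using card_lists_length_eq[of "UNIV :: 'a set" k] by simp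

text \<open>One more differentiation prepends one index, which is how consecutive Taylor terms are
  related below.\<close>

lemma sum_lists_length_Suc:
  fixes g :: "'a::finite list \<Rightarrow> 'b::comm_monoid_add"
  shows "(\<Sum>xs | length xs = Suc k. g xs) = (\<Sum>xs | length xs = k. \<Sum>i\<in>UNIV. g (i # xs))"
proof -
  have "(\<Sum>xs | length xs = k. \<Sum>i\<in>UNIV. g (i # xs))
     = (\<Sum>(xs, i)\<in>{xs. length xs = k} \<times> UNIV. g (i # xs))"
    by (simp add: sum.cartesian_product)
  also have "\<dots> = (\<Sum>xs | length xs = Suc k. g xs)"
    by (rule sum.reindex_bij_witness[of _ "\<lambda>xs. (tl xs, hd xs)" "\<lambda>(xs, i). i # xs"])
       (auto simp: length_Suc_conv)
  finally show ?thesis by simp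
qed

lemma sum_list_count_list: "(\<Sum>i\<in>UNIV. count_list xs i) = length (xs :: 'a::finite list)"
  by (rule sum_count_set) auto

lemma count_list_replicate: "count_list (replicate k a) j = (if a = j then k else 0)"
  by (induction k) auto

text \<open>Recovers a multi-index from the list of differentiations that
  \<open>multi_partial\<close> builds from it.\<close>

lemma count_list_concat_replicate:
  "distinct xs \<Longrightarrow> count_list (concat (map (\<lambda>i. replicate (h i) i) xs)) j = (if j \<in> set xs then h j else 0)"
  by (induction xs) (auto simp: count_list_append count_list_replicate)

section \<open>Tensor products of bumps as test functions\<close>

locale bump =
  fixes \<rho> :: "nat \<Rightarrow> real \<Rightarrow> real" and \<delta> :: real
  assumes deriv: "(\<rho> k has_real_derivative \<rho> (Suc k) t) (at t)"
    and nonneg: "\<rho> 0 t \<ge> 0"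
    and supp: "\<rho> 0 t \<noteq> 0 \<longleftrightarrow> 0 < t \<and> t < \<delta>"
    and pos: "\<delta> > 0"
begin

text \<open>\<open>\<kappa> i\<close> is the order of differentiation in coordinate
  \<open>i\<close>. The one-sided support of \<open>\<rho> 0\<close> places the kernel shifted by
  \<open>z\<close> in the cube from \<open>z\<close> to \<open>z + \<delta>\<close>.\<close>

definition tensor :: "('d::finite \<Rightarrow> nat) \<Rightarrow> real ^ 'd \<Rightarrow> real" where
  "tensor \<kappa> y = (\<Prod>i\<in>UNIV. \<rho> (\<kappa> i) (y $ i))"

lemma tensor_has_derivative:
  "(tensor \<kappa> has_derivative (\<lambda>v. \<Sum>i\<in>UNIV. v $ i * tensor (\<kappa>(i := Suc (\<kappa> i))) y)) (at y)"
proof -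
  have "((\<lambda>y. \<rho> (\<kappa> i) (y $ i)) has_derivative (\<lambda>v. \<rho> (Suc (\<kappa> i)) (y $ i) * (v $ i))) (at y)" for i
    using deriv[of "\<kappa> i" "y $ i"]
    by (rule has_derivative_compose[OF _ has_field_derivative_imp_has_derivative, rotated])
       (rule bounded_linear_imp_has_derivative, rule bounded_linear_vec_nth)
  then have "((\<lambda>y. \<Prod>i\<in>UNIV. \<rho> (\<kappa> i) (y $ i)) has_derivative
      (\<lambda>v. \<Sum>i\<in>UNIV. (\<rho> (Suc (\<kappa> i)) (y $ i) * (v $ i)) * (\<Prod>j\<in>UNIV - {i}. \<rho> (\<kappa> j) (y $ j)))) (at y)"
    by (intro has_derivative_prod)
  moreover have "tensor (\<kappa>(i := Suc (\<kappa> i))) y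
      = \<rho> (Suc (\<kappa> i)) (y $ i) * (\<Prod>j\<in>UNIV - {i}. \<rho> (\<kappa> j) (y $ j))" for i
    unfolding tensor_def by (subst prod.remove[of _ i]) auto
  ultimately show ?thesis
    by (simp add: tensor_def[abs_def] algebra_simps)
qed

lemma tensor_shift_has_derivative:
  "((\<lambda>y. tensor \<kappa> (y - z)) has_derivative (\<lambda>v. \<Sum>i\<in>UNIV. v $ i * tensor (\<kappa>(i := Suc (\<kappa> i))) (y - z))) (at y)"
  by (rule has_derivative_compose[OF _ tensor_has_derivative, where f' = "\<lambda>v. v", simplified])
     (auto intro!: derivative_eq_intros)

lemma continuous_tensor: "continuous_on S (tensor \<kappa>)"
  by (meson continuous_at_imp_continuous_on has_derivative_continuous tensor_has_derivative)

text \<open>Each partial derivative raises one entry of \<open>\<kappa>\<close> by one, so the order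
  of differentiation is forgotten. As \<open>tensor\<close> is differentiable for every
  \<open>\<kappa>\<close>, this also yields smoothness.\<close>

lemma iter_partial_tensor:
  "iter_partial is (\<lambda>y. tensor \<kappa> (y - z)) = (\<lambda>y. tensor (\<lambda>i. \<kappa> i + count_list is i) (y - z))"
proof (induction "is")
  case Nil
  show ?case by (simp add: iter_partial_def)
next
  case (Cons j "is")
  let ?\<kappa> = "\<lambda>i. \<kappa> i + count_list is i"
  have "partial_deriv j (\<lambda>y. tensor ?\<kappa> (y - z)) y = tensor (?\<kappa>(j := Suc (?\<kappa> j))) (y - z)" for y
  proof -
    have "frechet_derivative (\<lambda>y. tensor ?\<kappa> (y - z)) (at y) =
        (\<lambda>v. \<Sum>i\<in>UNIV. v $ i * tensor (?\<kappa>(i := Suc (?\<kappa> i))) (y - z))"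
      using frechet_derivative_at[OF tensor_shift_has_derivative[of ?\<kappa> z y]] by simp
    then show ?thesis
      by (simp add: partial_deriv_def axis_def if_distrib[of "\<lambda>a. a * _"] cong: if_cong)
  qed
  moreover have "?\<kappa>(j := Suc (?\<kappa> j)) = (\<lambda>i. \<kappa> i + count_list (j # is) i)" by auto
  ultimately show ?case
    using Cons by (simp add: iter_partial_def)
qed

lemma tensor_nonneg: "tensor (\<lambda>_. 0) y \<ge> 0"
  unfolding tensor_def by (intro prod_nonneg) (simp add: nonneg)

lemma tensor_supp: "tensor (\<lambda>_. 0) y \<noteq> 0 \<longleftrightarrow> (\<forall>i. 0 < y $ i \<and> y $ i < \<delta>)"
  by (simp add: tensor_def supp)

text \<open>The strict inequalities keep even the closed support inside the open cube.\<close>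

lemma test_fun_tensor:
  assumes "\<And>i. 0 < z $ i" "\<And>i. z $ i + \<delta> < 1"
  shows "test_fun (box 0 1) (\<lambda>y. tensor (\<lambda>_. 0) (y - z))"
proof -
  let ?K = "cbox z (z + (\<chi> i. \<delta>))"
  have "{y. tensor (\<lambda>_. 0) (y - z) \<noteq> 0} \<subseteq> ?K"
    unfolding tensor_supp by (auto simp: mem_box_cart less_imp_le algebra_simps)
  then have 1: "closure {y. tensor (\<lambda>_. 0) (y - z) \<noteq> 0} \<subseteq> ?K"
    by (rule closure_minimal) (rule closed_cbox)
  moreover have "?K \<subseteq> box 0 1"
    using assms by (auto simp: mem_box_cart) (meson less_le_trans, meson le_less_trans)
  moreover have "compact (closure {y. tensor (\<lambda>_. 0) (y - z) \<noteq> 0})"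
    using 1 compact_closure bounded_cbox bounded_subset closure_subset by blast
  moreover have "smooth_fun (\<lambda>y. tensor (\<lambda>_. 0) (y - z))"
    unfolding smooth_fun_def iter_partial_tensor
    using tensor_shift_has_derivative differentiable_def by blast
  ultimately show ?thesis by (auto simp: test_fun_def)
qed

text \<open>The normalizing constant of the mollifier; the type argument carries the
  dimension.\<close>

definition mass :: "'d::finite itself \<Rightarrow> real" where
  "mass _ = integral (cbox 0 (\<chi> i. \<delta>)) (tensor (\<lambda>_ :: 'd. 0))"

text \<open>A continuous nonnegative function with integral zero vanishes, but the kernel is
  positive at the centre of its support.\<close>

lemma mass_pos: "mass TYPE('d::finite) > 0"
proof -
  let ?D = "cbox 0 (\<chi> i. \<delta>) :: (real ^ 'd) set"
  let ?T = "tensor (\<lambda>_ :: 'd. 0)"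
  have "?T integrable_on ?D"
    by (rule integrable_continuous) (rule continuous_tensor)
  then have hi: "(?T has_integral mass TYPE('d)) ?D"
    by (simp add: mass_def has_integral_integrable_integral)
  have "mass TYPE('d) \<ge> 0"
    using hi by (rule has_integral_nonneg) (simp add: tensor_nonneg)
  moreover have "mass TYPE('d) \<noteq> 0"
  proof
    assume 0: "mass TYPE('d) = 0"
    have "?T (\<chi> i. \<delta> / 2) = 0"
    proof (rule has_integral_0_cbox_imp_0[OF continuous_tensor tensor_nonneg])
      show "(?T has_integral 0) ?D" using hi 0 by simp
      have "(\<chi> i. \<delta> / 2) \<in> box 0 ((\<chi> i. \<delta>) :: real ^ 'd)"
        using pos by (simp add: mem_box_cart)
      then show "box 0 ((\<chi> i. \<delta>) :: real ^ 'd) \<noteq> {}" by blast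
      show "(\<chi> i. \<delta> / 2) \<in> ?D" using pos by (simp add: mem_box_cart)
    qed
    then show False using tensor_supp[of "(\<chi> i. \<delta> / 2) :: real ^ 'd"] pos by simp
  qed
  ultimately show ?thesis by simp
qed

text \<open>Translate, then extend by zero from the support to the unit cube.\<close>

lemma tensor_shift_has_integral:
  fixes z :: "real ^ 'd"
  assumes "\<And>i. 0 \<le> z $ i" "\<And>i. z $ i + \<delta> \<le> 1"
  shows "((\<lambda>y. tensor (\<lambda>_. 0) (y - z)) has_integral mass TYPE('d)) (cbox 0 1)"
proof -
  have "(tensor (\<lambda>_ :: 'd. 0) has_integral mass TYPE('d)) (cbox 0 (\<chi> i. \<delta>))"
    by (simp add: mass_def has_integral_integrable_integral integrable_continuous continuous_tensor)
  from has_integral_affinity'[OF this zero_less_one, of "- z"]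
  have "((\<lambda>y. tensor (\<lambda>_. 0) (y - z)) has_integral mass TYPE('d)) (cbox z ((\<chi> i. \<delta>) + z))"
    by simp
  then show ?thesis
  proof (rule has_integral_on_superset)
    show "tensor (\<lambda>_. 0) (y - z) = 0" if "y \<notin> cbox z ((\<chi> i. \<delta>) + z)" for y
    proof (rule ccontr)
      assume "tensor (\<lambda>_. 0) (y - z) \<noteq> 0"
      then have "y \<in> cbox z ((\<chi> i. \<delta>) + z)"
        unfolding tensor_supp by (auto simp: mem_box_cart less_imp_le algebra_simps)
      with that show False by simp
    qed
    show "cbox z ((\<chi> i. \<delta>) + z) \<subseteq> cbox 0 1"
      using assms by (auto simp: mem_box_cart) (meson order_trans, metis add.commute order_trans)
  qed
qed

text \<open>For \<open>is = []\<close> this is the mollification of \<open>f\<close> at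
  \<open>z\<close> before division by the mass. For other lists it is the corresponding derivative
  in \<open>z\<close> up to the sign \<open>(-1) ^ length is\<close>, since the kernel is
  differentiated in \<open>y\<close>.\<close>

definition mollified :: "(real ^ 'd::finite \<Rightarrow> real) \<Rightarrow> 'd list \<Rightarrow> real ^ 'd \<Rightarrow> real" where
  "mollified f is z = integral (cbox 0 1) (\<lambda>y. f y * tensor (count_list is) (y - z))"

section \<open>Bounds and Taylor expansion of the mollified function\<close>

lemma continuous_tensor_shift: "continuous_on S (\<lambda>y. tensor \<kappa> (y - z))"
  by (rule continuous_on_compose2[OF continuous_tensor[of UNIV]]) (auto intro!: continuous_intros)

text \<open>The weak derivative moves from the mollifier to \<open>f\<close>; multi-indices are linked to index lists by
  counting, since the iterated partial derivatives of a tensor product only depend on the counts.\<close>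

lemma mollified_bound:
  fixes z :: "real ^ 'd"
  assumes wd: "has_weak_deriv (box 0 1) (\<chi> i. count_list is i) f g"
    and bnd: "AE y in lebesgue. y \<in> cbox 0 1 \<longrightarrow> \<bar>g y\<bar> \<le> 1"
    and cont: "continuous_on (cbox 0 1) f"
    and z: "\<And>i. 0 < z $ i" "\<And>i. z $ i + \<delta> < 1"
  shows "\<bar>mollified f is z\<bar> \<le> mass TYPE('d)"
proof -
  let ?\<phi> = "\<lambda>y. tensor (\<lambda>_. 0) (y - z)"
  let ?\<alpha> = "(\<chi> i. count_list is i) :: nat ^ 'd"
  have mp: "multi_partial ?\<alpha> ?\<phi> y = tensor (count_list is) (y - z)" for y
    unfolding multi_partial_def iter_partial_tensor
    by (simp add: count_list_concat_replicate coords)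
  have "(LINT x:box 0 1|lebesgue. f x * multi_partial ?\<alpha> ?\<phi> x) =
        (-1) ^ mi_order ?\<alpha> * (LINT x:box 0 1|lebesgue. g x * ?\<phi> x)"
    using wd test_fun_tensor[OF z] by (simp add: has_weak_deriv_def)
  moreover have "(LINT x:box 0 1|lebesgue. f x * multi_partial ?\<alpha> ?\<phi> x) = mollified f is z"
  proof -
    have "continuous_on (cbox 0 1) (\<lambda>y. f y * tensor (count_list is) (y - z))"
      by (intro continuous_intros cont continuous_tensor_shift)
    then have "set_integrable lebesgue (cbox 0 1) (\<lambda>y. f y * tensor (count_list is) (y - z))"
      by (rule absolutely_integrable_continuous)
    then have "set_integrable lebesgue (box 0 1) (\<lambda>y. f y * tensor (count_list is) (y - z))"
      by (rule set_integrable_subset) (auto simp: box_subset_cbox)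
    from set_lebesgue_integral_eq_integral(2)[OF this] show ?thesis
      by (simp add: mp mollified_def integral_open_interval)
  qed
  ultimately have "\<bar>mollified f is z\<bar> = \<bar>LINT x:box 0 1|lebesgue. g x * ?\<phi> x\<bar>"
    by (simp add: abs_mult power_abs)
  \<comment> \<open>Here \<open>\<bar>g\<bar> \<le> 1\<close> almost everywhere and the kernel is
    nonnegative, so the open cube may also be enlarged to the closed one.\<close>
  also have "\<dots> \<le> (LINT x:cbox 0 1|lebesgue. ?\<phi> x)"
    unfolding set_lebesgue_integral_def real_norm_def[symmetric]
  proof (rule order_trans[OF integral_norm_bound integral_mono_AE'])
    have "set_integrable lebesgue (cbox 0 1) ?\<phi>"
      by (rule absolutely_integrable_continuous) (rule continuous_tensor_shift)
    then show "integrable lebesgue (\<lambda>x. indicator (cbox 0 1) x *\<^sub>R ?\<phi> x)"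
      by (simp add: set_integrable_def)
    show "AE x in lebesgue. norm (indicator (box 0 1) x *\<^sub>R (g x * ?\<phi> x)) \<le> indicator (cbox 0 1) x *\<^sub>R ?\<phi> x"
      using bnd
    proof eventually_elim
      case (elim x)
      show ?case
      proof (cases "x \<in> box 0 1")
        case True
        then have "x \<in> cbox 0 1" using box_subset_cbox by blast
        with True elim show ?thesis
          using mult_right_mono[of "\<bar>g x\<bar>" 1 "?\<phi> x"] tensor_nonneg[of "x - z"] by (simp add: abs_mult)
      qed (simp add: tensor_nonneg)
    qed
    show "AE x in lebesgue. 0 \<le> indicator (cbox 0 1) x *\<^sub>R ?\<phi> x"
      by (simp add: tensor_nonneg)
  qed
  also have "\<dots> = mass TYPE('d)"
  proof -
    have "set_integrable lebesgue (cbox 0 1) ?\<phi>"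
      by (rule absolutely_integrable_continuous) (rule continuous_tensor_shift)
    from set_lebesgue_integral_eq_integral(2)[OF this] show ?thesis
      using tensor_shift_has_integral[of z] z by (simp add: less_imp_le integral_unique)
  qed
  finally show ?thesis .
qed

text \<open>Differentiation under the integral: \<open>z\<close> enters only through the smooth
  kernel, so continuity of \<open>f\<close> is enough. The sign comes from
  \<open>y - z\<close>.\<close>

lemma mollified_has_derivative_line:
  fixes z v :: "real ^ 'd"
  assumes cont: "continuous_on (cbox 0 1) f"
  shows "((\<lambda>t. mollified f is (z + t *\<^sub>R v)) has_real_derivative
      - (\<Sum>i\<in>UNIV. v $ i * mollified f (i # is) (z + t *\<^sub>R v))) (at t)"
proof -
  let ?d = "\<lambda>t y. f y * - (\<Sum>i\<in>UNIV. v $ i * tensor (count_list (i # is)) (y - (z + t *\<^sub>R v)))"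
  have cl: "(count_list is)(i := Suc (count_list is i)) = count_list (i # is)" for i by auto
  have a: "((\<lambda>t. f y * tensor (count_list is) (y - (z + t *\<^sub>R v))) has_field_derivative ?d t y) (at t within UNIV)" for t y
  proof -
    have "((\<lambda>t. tensor (count_list is) (y - (z + t *\<^sub>R v))) has_derivative
       (\<lambda>s. \<Sum>i\<in>UNIV. (- (s *\<^sub>R v)) $ i * tensor ((count_list is)(i := Suc (count_list is i))) (y - (z + t *\<^sub>R v)))) (at t)"
      by (rule has_derivative_compose[OF _ tensor_has_derivative]) (auto intro!: derivative_eq_intros)
    then have "((\<lambda>t. tensor (count_list is) (y - (z + t *\<^sub>R v))) has_real_derivative
       - (\<Sum>i\<in>UNIV. v $ i * tensor (count_list (i # is)) (y - (z + t *\<^sub>R v)))) (at t)"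
      unfolding cl has_field_derivative_def
      by (rule has_derivative_eq_rhs) (simp add: fun_eq_iff sum_distrib_left sum_negf algebra_simps)
    then show ?thesis by (intro DERIV_cmult) simp
  qed
  have b: "(\<lambda>y. f y * tensor (count_list is) (y - (z + t *\<^sub>R v))) integrable_on cbox 0 1" for t
    by (intro integrable_continuous continuous_intros cont continuous_tensor_shift)
  have c: "continuous_on (UNIV \<times> cbox 0 1) (\<lambda>(t, y). ?d t y)"
    unfolding case_prod_beta
    by (intro continuous_intros continuous_on_compose2[OF cont] continuous_on_compose2[OF continuous_tensor[of UNIV]]) auto
  have "((\<lambda>t. integral (cbox 0 1) (\<lambda>y. f y * tensor (count_list is) (y - (z + t *\<^sub>R v))))
      has_field_derivative integral (cbox 0 1) (?d t)) (at t within UNIV)"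
    by (rule leibniz_rule_field_derivative[OF a b c]) auto
  moreover have "integral (cbox 0 1) (?d t) = - (\<Sum>i\<in>UNIV. v $ i * mollified f (i # is) (z + t *\<^sub>R v))"
  proof -
    have "?d t y = - (\<Sum>i\<in>UNIV. v $ i * (f y * tensor (count_list (i # is)) (y - (z + t *\<^sub>R v))))" for y
      by (simp add: sum_distrib_left algebra_simps)
    moreover have "(\<lambda>y. v $ i * (f y * tensor (count_list (i # is)) (y - (z + t *\<^sub>R v)))) integrable_on cbox 0 1" for i
      by (intro integrable_continuous continuous_intros cont continuous_tensor_shift)
    ultimately show ?thesis
      by (simp add: integral_sum mollified_def del: count_list.simps)
  qed
  ultimately show ?thesis by (simp add: mollified_def[abs_def] del: count_list.simps)
qed

text \<open>Taylor's formula in one variable on the segment from \<open>z\<close> to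
  \<open>z + v\<close>. Summing over ordered index lists avoids multinomial coefficients; the
  remainder consists of \<open>CARD('d) ^ n\<close> terms of size at most \<open>h ^ n * c\<close>,
  taken at an interior point of the segment.\<close>

lemma mollified_taylor:
  fixes z v :: "real ^ 'd" and h c :: real
  assumes cont: "continuous_on (cbox 0 1) f" and n: "n > 0"
    and bnd: "\<And>is t. length is = n \<Longrightarrow> 0 < t \<Longrightarrow> t < 1 \<Longrightarrow> \<bar>mollified f is (z + t *\<^sub>R v)\<bar> \<le> c"
    and v: "\<And>i. \<bar>v $ i\<bar> \<le> h"
  shows "\<bar>mollified f [] (z + v) -
      (\<Sum>k<n. \<Sum>is | length is = k. (-1) ^ k / fact k * mollified f is z * (\<Prod>i\<leftarrow>is. v $ i))\<bar>
     \<le> (CARD('d) * h) ^ n * c"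
proof -
  \<comment> \<open>The factor \<open>(-1) ^ k\<close> cancels the sign of each differentiation, so
    \<open>G k\<close> is the \<open>k\<close>-th derivative of \<open>G 0\<close>.\<close>
  define G where "G k t = (-1) ^ k * (\<Sum>is | length is = k. (\<Prod>i\<leftarrow>is. v $ i) * mollified f is (z + t *\<^sub>R v))" for k t
  have "(G k has_real_derivative G (Suc k) t) (at t)" for k t
  proof -
    have "(G k has_real_derivative
      (-1) ^ k * (\<Sum>is | length is = k. (\<Prod>i\<leftarrow>is. v $ i) * - (\<Sum>i\<in>UNIV. v $ i * mollified f (i # is) (z + t *\<^sub>R v)))) (at t)"
      unfolding G_def
      by (intro DERIV_cmult DERIV_sum mollified_has_derivative_line cont)
    then show ?thesis
      by (simp add: G_def sum_lists_length_Suc sum_distrib_left sum_negf algebra_simps)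
  qed
  then have "\<exists>t>0. t < 1 \<and> G 0 1 = (\<Sum>k<n. G k 0 / fact k * (1 - 0) ^ k) + G n t / fact n * (1 - 0) ^ n"
    using Taylor_up[of n G "G 0" 0 1 0] n by auto
  then obtain t where t: "0 < t" "t < 1" "G 0 1 = (\<Sum>k<n. G k 0 / fact k) + G n t / fact n"
    by auto
  have h: "h \<ge> 0" using v[of undefined] by linarith
  have prod_le: "\<bar>\<Prod>i\<leftarrow>is. v $ i\<bar> \<le> h ^ length is" for "is"
    by (induction "is") (auto simp: abs_mult intro!: mult_mono v h)
  have "\<bar>G n t\<bar> = \<bar>\<Sum>is | length is = n. (\<Prod>i\<leftarrow>is. v $ i) * mollified f is (z + t *\<^sub>R v)\<bar>"
    by (simp add: G_def abs_mult power_abs)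
  also have "\<dots> \<le> (\<Sum>is | length (is :: 'd list) = n. h ^ n * c)"
  proof (rule order_trans[OF sum_abs], rule sum_mono)
    fix "is" :: "'d list" assume "is \<in> {is. length is = n}"
    then have "length is = n" by simp
    then show "\<bar>(\<Prod>i\<leftarrow>is. v $ i) * mollified f is (z + t *\<^sub>R v)\<bar> \<le> h ^ n * c"
      unfolding abs_mult using prod_le[of "is"] bnd[of "is" t] t h by (intro mult_mono) auto
  qed
  also have "\<dots> = (CARD('d) * h) ^ n * c"
    by (simp add: card_lists_length power_mult_distrib)
  finally have Gn: "\<bar>G n t\<bar> \<le> (CARD('d) * h) ^ n * c" .
  have "\<bar>G n t / fact n\<bar> \<le> \<bar>G n t\<bar>"
    using fact_ge_1[of n, where 'a = real] by (simp add: abs_divide divide_le_eq mult_le_cancel_left1)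
  moreover have G0: "G 0 1 = mollified f [] (z + v)" by (simp add: G_def)
  moreover have Gk: "G k 0 / fact k = (\<Sum>is | length is = k. (-1) ^ k / fact k * mollified f is z * (\<Prod>i\<leftarrow>is. v $ i))" for k
    by (simp add: G_def sum_distrib_left sum_divide_distrib algebra_simps)
  ultimately show ?thesis using t(3) Gn unfolding G0 Gk by linarith
qed

end

section \<open>Smooth approximation of Sobolev functions\<close>

lemma sobolev_weak_deriv_bound:
  fixes f :: "real ^ 'd \<Rightarrow> real"
  assumes "f \<in> sobolev_space n" "sobolev_norm n f \<le> 1" "mi_order \<alpha> \<le> n"
  obtains g where "has_weak_deriv (box 0 1) \<alpha> f g"
    "AE y in lebesgue. y \<in> cbox 0 1 \<longrightarrow> \<bar>g y\<bar> \<le> 1"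
proof -
  let ?g = "weak_deriv \<alpha> f" and ?M = "lebesgue_on (cbox 0 (1 :: real ^ 'd))"
  \<comment> \<open>Membership in the Sobolev space makes the choice in \<open>weak_deriv\<close>
    meaningful; its essential supremum is then one of the finitely many entries of the
    maximum.\<close>
  have "has_weak_deriv (box 0 1) \<alpha> f ?g"
    unfolding weak_deriv_def using assms(1,3)
    by (intro someI_ex[of "has_weak_deriv (box 0 1) \<alpha> f"]) (auto simp: sobolev_space_def)
  moreover have "esssup ?M (\<lambda>x. ereal \<bar>?g x\<bar>) \<le> sobolev_norm n f"
    unfolding sobolev_norm_def using assms(3) finite_mi_order_le by (intro Max_ge) auto
  then have "esssup ?M (\<lambda>x. ereal \<bar>?g x\<bar>) \<le> 1"
    using assms(2) by (rule order_trans)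
  then have "AE x in ?M. ereal \<bar>?g x\<bar> \<le> 1"
    using esssup_AE[of "\<lambda>x. ereal \<bar>?g x\<bar>" ?M] by (elim eventually_mono) (rule order_trans)
  then have "AE y in lebesgue. y \<in> cbox 0 1 \<longrightarrow> \<bar>?g y\<bar> \<le> 1"
    by (subst (asm) AE_restrict_space_iff) auto
  ultimately show ?thesis using that by blast
qed

text \<open>\<open>H\<close> is the normalized mollification of \<open>f\<close> composed with a
  contraction \<open>\<tau>\<close> of the cube. The coefficients \<open>c\<close> are chosen before
  \<open>h\<close> and \<open>x\<close>, so one polynomial per centre serves all nearby
  points.\<close>

lemma smooth_approx:
  fixes f :: "real ^ 'd \<Rightarrow> real"
  assumes n: "n > 0" and f: "f \<in> sobolev_space n" "sobolev_norm n f \<le> 1"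
    and cont: "continuous_on (cbox 0 1) f" and e: "e > 0"
  obtains H where "\<And>x. x \<in> cbox 0 1 \<Longrightarrow> \<bar>f x - H x\<bar> \<le> e"
    "\<And>x0. x0 \<in> cbox 0 1 \<Longrightarrow> \<exists>c. \<forall>h::real. \<forall>x\<in>cbox 0 1. (\<forall>i. \<bar>x $ i - x0 $ i\<bar> \<le> h) \<longrightarrow>
       \<bar>H x - (\<Sum>is | length is < n. c is * (\<Prod>i\<leftarrow>is. x $ i - x0 $ i))\<bar> \<le> (real CARD('d) * h) ^ n"
proof -
  let ?Q = "cbox 0 (1 :: real ^ 'd)" and ?d = "real CARD('d)"
  have "uniformly_continuous_on ?Q f"
    by (rule compact_uniformly_continuous[OF cont compact_cbox])
  then obtain \<eta> where \<eta>: "\<eta> > 0"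
    "\<And>x y. x \<in> ?Q \<Longrightarrow> y \<in> ?Q \<Longrightarrow> dist y x < \<eta> \<Longrightarrow> dist (f y) (f x) < e"
    using e unfolding uniformly_continuous_on_def by metis
  \<comment> \<open>The bound \<open>1 / 4\<close> keeps \<open>1 - 3 * \<delta>\<close> positive.
    The other makes points that differ by at most \<open>3 * \<delta>\<close> in each coordinate
    closer than \<open>\<eta>\<close>.\<close>
  define \<delta> where "\<delta> = min (1 / 4) (\<eta> / (4 * ?d))"
  have d: "?d > 0" by simp
  have \<delta>: "0 < \<delta>" "\<delta> \<le> 1 / 4" "3 * \<delta> * ?d < \<eta>"
  proof -
    show "0 < \<delta>" "\<delta> \<le> 1 / 4" using \<eta>(1) d by (auto simp: \<delta>_def)
    have "\<delta> * (4 * ?d) \<le> \<eta>"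
      using d by (simp add: \<delta>_def pos_le_divide_eq[symmetric])
    then show "3 * \<delta> * ?d < \<eta>" using mult_pos_pos[OF \<open>0 < \<delta>\<close> d] by (simp add: algebra_simps)
  qed
  obtain \<rho> :: "nat \<Rightarrow> real \<Rightarrow> real" where \<rho>: "\<And>k t. (\<rho> k has_real_derivative \<rho> (Suc k) t) (at t)"
    "\<And>t. \<rho> 0 t \<ge> 0" "\<And>t. \<rho> 0 t \<noteq> 0 \<longleftrightarrow> 0 < t \<and> t < \<delta>"
    by (rule bump_chain[of \<delta>]; rule that; assumption)
  interpret bump \<rho> \<delta> by unfold_locales (rule \<rho> \<delta>)+
  \<comment> \<open>Coordinates of \<open>\<tau> x\<close> lie between \<open>\<delta>\<close> and
    \<open>1 - 2 * \<delta>\<close>, so the kernel at \<open>\<tau> x\<close> stays at distance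
    \<open>\<delta>\<close> from the faces of the cube.\<close>
  define \<tau> where "\<tau> x = (\<chi> i. \<delta> + (1 - 3 * \<delta>) * x $ i)" for x :: "real ^ 'd"
  have \<tau>: "\<delta> \<le> \<tau> x $ i" "\<tau> x $ i \<le> 1 - 2 * \<delta>" "\<bar>\<tau> x $ i - x $ i\<bar> \<le> 2 * \<delta>" if "x \<in> ?Q" for x i
  proof -
    have x: "0 \<le> x $ i" "x $ i \<le> 1" using that by (auto simp: mem_box_cart)
    have "0 \<le> (1 - 3 * \<delta>) * x $ i" "(1 - 3 * \<delta>) * x $ i \<le> 1 - 3 * \<delta>"
      using x \<delta> by (auto intro: mult_left_le)
    then show "\<delta> \<le> \<tau> x $ i" "\<tau> x $ i \<le> 1 - 2 * \<delta>" by (auto simp: \<tau>_def)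
    have "\<delta> * x $ i \<le> \<delta>" "0 \<le> \<delta> * x $ i" using x \<delta> by (auto intro: mult_left_le)
    then show "\<bar>\<tau> x $ i - x $ i\<bar> \<le> 2 * \<delta>"
      by (simp add: \<tau>_def algebra_simps abs_le_iff)
  qed
  let ?m = "mass TYPE('d)"
  define H where "H x = mollified f [] (\<tau> x) / ?m" for x
  have m: "?m > 0" by (rule mass_pos)
  show ?thesis
  proof (rule that[of H])
    fix x assume x: "x \<in> ?Q"
    let ?T = "\<lambda>y. tensor (\<lambda>_. 0) (y - \<tau> x)"
    have T: "(?T has_integral ?m) ?Q"
      using \<tau>[OF x] \<delta> by (intro tensor_shift_has_integral) (smt (verit))+
    have "\<bar>integral ?Q (\<lambda>y. (f y - f x) * ?T y)\<bar> \<le> integral ?Q (\<lambda>y. e * ?T y)"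
      unfolding real_norm_def[symmetric]
    proof (rule integral_norm_bound_integral)
      show "(\<lambda>y. (f y - f x) * ?T y) integrable_on ?Q"
        by (intro integrable_continuous continuous_intros cont continuous_tensor_shift)
      show "(\<lambda>y. e * ?T y) integrable_on ?Q"
        by (intro integrable_continuous continuous_intros cont continuous_tensor_shift)
      fix y assume y: "y \<in> ?Q"
      show "norm ((f y - f x) * ?T y) \<le> e * ?T y"
      proof (cases "?T y = 0")
        case False
        \<comment> \<open>At most \<open>2 * \<delta>\<close> from moving \<open>x\<close> to
          \<open>\<tau> x\<close>, and \<open>\<delta>\<close> from the width of the kernel.\<close>
        have "\<bar>y $ i - x $ i\<bar> \<le> 3 * \<delta>" for i
          using \<tau>(3)[OF x, of i] False[unfolded tensor_supp, rule_format, of i]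
          by (simp add: abs_le_iff)
        then have "dist y x \<le> (\<Sum>i\<in>(UNIV :: 'd set). 3 * \<delta>)"
          unfolding dist_norm by (intro order_trans[OF norm_le_l1_cart] sum_mono) simp
        also have "\<dots> < \<eta>" using \<delta> by (simp add: mult.commute)
        finally have "dist (f y) (f x) < e" using \<eta>(2)[OF x y] by simp
        then show ?thesis
          using tensor_nonneg[of "y - \<tau> x"] by (simp add: abs_mult dist_real_def mult_right_mono)
      qed simp
    qed
    also have "integral ?Q (\<lambda>y. e * ?T y) = e * ?m"
      using T by (simp add: integral_unique)
    also have "integral ?Q (\<lambda>y. (f y - f x) * ?T y) = ?m * (H x - f x)"
    proof -
      have "(\<lambda>y. f y * ?T y) integrable_on ?Q"
        by (intro integrable_continuous continuous_intros cont continuous_tensor_shift)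
      moreover have "count_list [] = (\<lambda>_ :: 'd. 0)" by auto
      ultimately have "((\<lambda>y. f y * ?T y) has_integral ?m * H x) ?Q"
        using m by (simp add: H_def mollified_def has_integral_integrable_integral)
      from has_integral_diff[OF this has_integral_mult_right[OF T, of "f x"]]
      have "((\<lambda>y. (f y - f x) * ?T y) has_integral ?m * (H x - f x)) ?Q"
        by (simp add: algebra_simps)
      then show ?thesis by (rule integral_unique)
    qed
    finally show "\<bar>f x - H x\<bar> \<le> e"
      using m by (simp add: abs_mult abs_minus_commute mult.commute)
  next
    fix x0 assume x0: "x0 \<in> ?Q"
    \<comment> \<open>Taylor coefficients at \<open>\<tau> x0\<close>, with the scaling of
      \<open>\<tau>\<close> and the normalization absorbed.\<close>
    define c where "c is = (-1) ^ length is / fact (length is) * mollified f is (\<tau> x0)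
        * (1 - 3 * \<delta>) ^ length is / ?m" for "is"
    have "\<bar>H x - (\<Sum>is | length is < n. c is * (\<Prod>i\<leftarrow>is. x $ i - x0 $ i))\<bar> \<le> (real CARD('d) * h) ^ n"
      if x: "x \<in> ?Q" and h: "\<And>i. \<bar>x $ i - x0 $ i\<bar> \<le> h" for h :: real and x
    proof -
      define v where "v = (1 - 3 * \<delta>) *\<^sub>R (x - x0)"
      \<comment> \<open>As \<open>\<tau>\<close> is affine, the segment from
        \<open>\<tau> x0\<close> to \<open>\<tau> x\<close> is the image of a segment in the cube,
        where the derivative bound applies.\<close>
      have tv: "\<tau> x0 + t *\<^sub>R v = \<tau> (x0 + t *\<^sub>R (x - x0))" for t
        by (simp add: \<tau>_def v_def vec_eq_iff algebra_simps)
      have "\<bar>mollified f [] (\<tau> x0 + v) -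
         (\<Sum>k<n. \<Sum>is | length is = k. (-1) ^ k / fact k * mollified f is (\<tau> x0) * (\<Prod>i\<leftarrow>is. v $ i))\<bar>
         \<le> (real CARD('d) * h) ^ n * ?m"
      proof (rule mollified_taylor[OF cont n])
        fix "is" :: "'d list" and t :: real
        assume "length is = n" and t: "0 < t" "t < 1"
        then have "mi_order ((\<chi> i. count_list is i) :: nat ^ 'd) \<le> n"
          by (simp add: mi_order_def sum_list_count_list)
        then obtain g where g: "has_weak_deriv (box 0 1) (\<chi> i. count_list is i) f g"
          "AE y in lebesgue. y \<in> cbox 0 1 \<longrightarrow> \<bar>g y\<bar> \<le> 1"
          using sobolev_weak_deriv_bound[OF f] by blast
        have "(1 - t) *\<^sub>R x0 + t *\<^sub>R x \<in> ?Q"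
          using convex_box(1)[of 0 1] x x0 t by (intro convexD) auto
        then have xt: "x0 + t *\<^sub>R (x - x0) \<in> ?Q" by (simp add: algebra_simps)
        show "\<bar>mollified f is (\<tau> x0 + t *\<^sub>R v)\<bar> \<le> ?m"
          unfolding tv
          by (rule mollified_bound[OF g cont]) (use \<tau>[OF xt] \<delta> in \<open>smt (verit)\<close>)+
      next
        fix i
        have "\<bar>v $ i\<bar> = (1 - 3 * \<delta>) * \<bar>x $ i - x0 $ i\<bar>"
          using \<delta> by (simp add: v_def abs_mult)
        also have "\<dots> \<le> 1 * \<bar>x $ i - x0 $ i\<bar>" using \<delta> by (intro mult_right_mono) auto
        also have "\<dots> \<le> h" using h[of i] by simp
        finally show "\<bar>v $ i\<bar> \<le> h" .
      qed
      moreover have "\<tau> x0 + v = \<tau> x" using tv[of 1] by simp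
      moreover have "(\<Sum>k<n. \<Sum>is | length is = k. (-1) ^ k / fact k * mollified f is (\<tau> x0) * (\<Prod>i\<leftarrow>is. v $ i))
          = ?m * (\<Sum>is | length is < n. c is * (\<Prod>i\<leftarrow>is. x $ i - x0 $ i))"
      proof -
        have pv: "(\<Prod>i\<leftarrow>is. v $ i) = (1 - 3 * \<delta>) ^ length is * (\<Prod>i\<leftarrow>is. x $ i - x0 $ i)" for "is"
          by (induction "is") (auto simp: v_def)
        have "{is :: 'd list. length is < n} = (\<Union>k<n. {is. length is = k})" by auto
        then have "(\<Sum>is | length is < n. c is * (\<Prod>i\<leftarrow>is. x $ i - x0 $ i))
           = (\<Sum>k<n. \<Sum>is | length is = k. c is * (\<Prod>i\<leftarrow>is. x $ i - x0 $ i))"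
          by (simp, subst sum.UNION_disjoint) (auto simp: finite_lists_length)
        also have "?m * \<dots> = (\<Sum>k<n. \<Sum>is | length is = k. (-1) ^ k / fact k * mollified f is (\<tau> x0) * (\<Prod>i\<leftarrow>is. v $ i))"
          unfolding sum_distrib_left
          using m by (intro sum.cong refl) (simp add: c_def pv)
        finally show ?thesis by simp
      qed
      ultimately have "\<bar>?m * (H x - (\<Sum>is | length is < n. c is * (\<Prod>i\<leftarrow>is. x $ i - x0 $ i)))\<bar>
          \<le> ?m * (real CARD('d) * h) ^ n"
        using m by (simp add: H_def algebra_simps)
      then show ?thesis
        using m by (simp add: abs_mult)
    qed
    then show "\<exists>c. \<forall>h::real. \<forall>x\<in>?Q. (\<forall>i. \<bar>x $ i - x0 $ i\<bar> \<le> h) \<longrightarrow>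
       \<bar>H x - (\<Sum>is | length is < n. c is * (\<Prod>i\<leftarrow>is. x $ i - x0 $ i))\<bar> \<le> (real CARD('d) * h) ^ n"
      by blast
  qed
qed

section \<open>Local Taylor polynomials and a partition of unity\<close>

text \<open>The triangle function with nodes \<open>-1\<close>, \<open>0\<close>, \<open>1\<close>,
  written as a combination of three \<open>ReLU\<close> units.\<close>

definition hat :: "real \<Rightarrow> real" where
  "hat t = max 0 (t + 1) - 2 * max 0 t + max 0 (t - 1)"

lemma hat_nonneg: "hat t \<ge> 0"
  by (auto simp: hat_def max_def)

lemma hat_supp: "hat t \<noteq> 0 \<Longrightarrow> \<bar>t\<bar> \<le> 1"
  by (auto simp: hat_def max_def abs_if split: if_splits)

text \<open>\<open>hat\<close> is a second difference of \<open>max 0\<close>, so the sum telescopes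
  to two first differences; on the given range they equal \<open>1\<close> and
  \<open>0\<close>.\<close>

lemma sum_hat:
  assumes "0 \<le> t" "t \<le> real N"
  shows "(\<Sum>j\<le>N. hat (t - real j)) = 1"
proof -
  have "(\<Sum>j\<le>N. hat (t - real j))
     = (max 0 (t + 1) - max 0 t) - (max 0 (t - real N) - max 0 (t - real N - 1))" for N
    by (induction N) (auto simp: hat_def algebra_simps)
  then show ?thesis using assms by simp
qed

text \<open>Three \<open>ReLU\<close> units at a cost of \<open>4\<close> each.\<close>

lemma realizes_hat: "realizes [ReLU] 12 (\<lambda>x. hat (r * x $ i - s))"
proof -
  have "realizes ([] @ [ReLU]) ((2 + 2) + (2 + 2) + (2 + 2))
    (\<lambda>x. act_fun ReLU (r * x $ i + (1 - s)) + (- 2 * act_fun ReLU (r * x $ i + (- s)) + 0)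
       + act_fun ReLU (r * x $ i + (- 1 - s)))"
    by (intro realizes_add realizes_affine realizes_act realizes_coord)
  then show ?thesis by (simp add: hat_def[abs_def] algebra_simps)
qed

text \<open>A linear function crosses the \<open>ReLU\<close> layer as the difference of its
  positive and negative parts. The cost is padded to \<open>12\<close> so that all factors share one
  bound.\<close>

lemma realizes_shift: "realizes [ReLU] 12 (\<lambda>x :: real ^ 'd. x $ i - s)"
proof -
  have "realizes ([] @ [ReLU]) ((2 + 2) + (2 + 2))
    (\<lambda>x :: real ^ 'd. act_fun ReLU (1 * x $ i + (- s)) + (- 1 * act_fun ReLU (- 1 * x $ i + s) + 0))"
    by (intro realizes_add realizes_affine realizes_act realizes_coord)
  moreover have "(\<lambda>x :: real ^ 'd. act_fun ReLU (1 * x $ i + (- s)) +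
      (- 1 * act_fun ReLU (- 1 * x $ i + s) + 0)) = (\<lambda>x. x $ i - s)"
    by (auto simp: max_def)
  ultimately have "realizes [ReLU] 8 (\<lambda>x :: real ^ 'd. x $ i - s)"
    by (simp del: act_fun.simps)
  then show ?thesis by (rule realizes_mono) simp
qed

section \<open>Assembly of the network and parameter count\<close>

theorem theorem1p3:
  fixes n :: nat
  assumes "n \<ge> 1"
  shows "\<exists>C::real. C > 0 \<and>
    (\<forall>\<epsilon>::real. 0 < \<epsilon> \<and> \<epsilon> < 1 \<longrightarrow>
      (\<forall>f :: real ^ 'd \<Rightarrow> real.
        f \<in> sobolev_space n \<and> continuous_on (cbox 0 1) f \<and> sobolev_norm n f \<le> 1 \<longrightarrow>
        (\<exists>A. valid_architecture CARD('d) A \<and>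
             real (card (params A)) \<le> C * \<epsilon> powr (- (real CARD('d) / real n)) \<and>
             (\<exists>a \<in> params A \<rightarrow>\<^sub>E (UNIV :: real set).
                \<forall>x \<in> cbox 0 1. \<bar>f x - network A a x\<bar> \<le> \<epsilon>))))"
proof -
  let ?d = "CARD('d)"
  \<comment> \<open>\<open>P\<close> is fixed before \<open>\<epsilon>\<close> and \<open>f\<close>.
    A product has \<open>?d\<close> hat factors and fewer than \<open>n\<close> linear ones.\<close>
  obtain P where P: "\<And>gs :: (real ^ 'd \<Rightarrow> real) list. length gs \<le> ?d + n \<Longrightarrow>
     (\<And>g. g \<in> set gs \<Longrightarrow> realizes [ReLU] 12 g) \<Longrightarrow>
     realizes ([ReLU] @ replicate (?d + n) Square) P (\<lambda>x. prod_list (map (\<lambda>g. g x) gs))"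
    using realizes_prod_list[where 'd = 'd] by blast
  let ?acts = "[ReLU] @ replicate (?d + n) Square"
  let ?L = "{is :: 'd list. length is < n}"
  have L: "finite ?L" "?L \<noteq> {}"
  proof -
    have "?L = (\<Union>k<n. {is. length is = k})" by auto
    then show "finite ?L" by (simp add: finite_lists_length)
    show "?L \<noteq> {}" using assms by (auto intro: exI[of _ "[]"])
  qed
  \<comment> \<open>The power bounds the number of grid points relative to
    \<open>\<epsilon> powr (- (?d / n))\<close>, \<open>card ?L\<close> counts the terms of a Taylor
    polynomial, and \<open>Suc P\<close> makes \<open>C\<close> positive whatever \<open>P\<close>
    is.\<close>
  define C where "C = (2 * real ?d + 2) ^ ?d * real (card ?L * Suc P)"
  show ?thesis
  proof (intro exI[of _ C] conjI allI impI)
    have "card ?L * Suc P > 0" using L by (auto simp: card_gt_0_iff)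
    then have "real (card ?L * Suc P) > 0" by (simp only: of_nat_0_less_iff)
    moreover have "2 * real ?d + 2 > 0" by (simp add: add_nonneg_pos)
    ultimately show "C > 0" unfolding C_def by (intro mult_pos_pos zero_less_power)
    fix \<epsilon> :: real and f :: "real ^ 'd \<Rightarrow> real"
    assume "0 < \<epsilon> \<and> \<epsilon> < 1"
      and "f \<in> sobolev_space n \<and> continuous_on (cbox 0 1) f \<and> sobolev_norm n f \<le> 1"
    then have \<epsilon>: "0 < \<epsilon>" "\<epsilon> < 1" and f: "f \<in> sobolev_space n" "sobolev_norm n f \<le> 1"
        "continuous_on (cbox 0 1) f" by auto
    \<comment> \<open>Half of \<open>\<epsilon>\<close> goes to smoothing, the other half to the
      Taylor remainder.\<close>
    have e2: "\<epsilon> / 2 > 0" and n0: "n > 0" using \<epsilon> assms by auto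
    obtain H where H: "\<And>x. x \<in> cbox 0 1 \<Longrightarrow> \<bar>f x - H x\<bar> \<le> \<epsilon> / 2"
      "\<And>x0. x0 \<in> cbox 0 1 \<Longrightarrow> \<exists>c. \<forall>h::real. \<forall>x\<in>cbox 0 1. (\<forall>i. \<bar>x $ i - x0 $ i\<bar> \<le> h) \<longrightarrow>
       \<bar>H x - (\<Sum>is | length is < n. c is * (\<Prod>i\<leftarrow>is. x $ i - x0 $ i))\<bar> \<le> (real ?d * h) ^ n"
      by (rule smooth_approx[OF n0 f e2]; rule that; assumption)
    \<comment> \<open>\<open>q\<close> solves \<open>q ^ n = 2 / \<epsilon>\<close>, so
      \<open>N \<ge> ?d * q\<close> forces \<open>(?d / N) ^ n \<le> \<epsilon> / 2\<close>;
      \<open>r\<close> is the scale in which \<open>N\<close> is finally measured.\<close>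
    define q where "q = (2 / \<epsilon>) powr (1 / n)"
    define r where "r = \<epsilon> powr (- (1 / n))"
    define N where "N = nat \<lceil>?d * q\<rceil>"
    have q: "q > 0" "q ^ n = 2 / \<epsilon>"
      using \<epsilon> assms by (auto simp: q_def powr_realpow[symmetric] powr_powr)
    have r1: "r = 1 / \<epsilon> powr (1 / n)"
      by (simp add: r_def powr_minus_divide)
    have "\<epsilon> powr (1 / n) \<le> 1 powr (1 / n)" using \<epsilon> by (intro powr_mono2) auto
    then have r: "r \<ge> 1" using \<epsilon> by (simp add: r1)
    have "2 powr (1 / n) \<le> (2::real) powr 1" using assms by (intro powr_mono) auto
    then have "2 powr (1 / n) * r \<le> 2 * r" using r by (intro mult_right_mono) auto
    moreover have "q = 2 powr (1 / n) * r"
      using \<epsilon> by (simp add: q_def r1 powr_divide)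
    ultimately have q2: "q \<le> 2 * r" by simp
    have dq: "0 < ?d * q" using q by simp
    have N: "?d * q \<le> N" unfolding N_def by (rule real_nat_ceiling_ge)
    have N2: "N \<le> ?d * q + 1"
      using dq of_int_ceiling_le_add_one[of "?d * q"] by (simp add: N_def)
    have N0: "N > 0" using dq N by (cases "N = 0") auto
    have Nerr: "(?d * (1 / N)) ^ n \<le> \<epsilon> / 2"
    proof -
      have "?d * (1 / N) \<le> 1 / q" using N N0 q by (simp add: field_simps)
      then have "(?d * (1 / N)) ^ n \<le> (1 / q) ^ n" by (intro power_mono) auto
      also have "\<dots> = \<epsilon> / 2" using q by (simp add: power_divide)
      finally show ?thesis .
    qed
    define G where "G = (UNIV :: 'd set) \<rightarrow>\<^sub>E {..N}"
    define pt where "pt m = (\<chi> i. real (m i) / N)" for m :: "'d \<Rightarrow> nat"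
    define \<phi> where "\<phi> m x = (\<Prod>i\<in>UNIV. hat (N * x $ i - real (m i)))" for m and x :: "real ^ 'd"
    have G: "finite G" "G \<noteq> {}" "card G = (N + 1) ^ ?d"
      by (auto simp: G_def PiE_eq_empty_iff card_PiE intro!: finite_PiE)
    have "pt m \<in> cbox 0 1" if "m \<in> G" for m
      using that N0 by (auto simp: G_def pt_def mem_box_cart PiE_iff divide_le_eq)
    then have "\<forall>m\<in>G. \<exists>c. \<forall>h::real. \<forall>x\<in>cbox 0 1. (\<forall>i. \<bar>x $ i - pt m $ i\<bar> \<le> h) \<longrightarrow>
       \<bar>H x - (\<Sum>is | length is < n. c is * (\<Prod>i\<leftarrow>is. x $ i - pt m $ i))\<bar> \<le> (real ?d * h) ^ n"
      by (intro ballI H(2))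
    from bchoice[OF this] obtain c where c: "\<forall>m\<in>G. \<forall>h::real. \<forall>x\<in>cbox 0 1. (\<forall>i. \<bar>x $ i - pt m $ i\<bar> \<le> h) \<longrightarrow>
       \<bar>H x - (\<Sum>is | length is < n. c m is * (\<Prod>i\<leftarrow>is. x $ i - pt m $ i))\<bar> \<le> (real ?d * h) ^ n" ..
    define T where "T m x = (\<Sum>is | length is < n. c m is * (\<Prod>i\<leftarrow>is. x $ i - pt m $ i))" for m x
    \<comment> \<open>The double sum is flattened so that every summand is a multiple of a single
      product of one-layer factors.\<close>
    define g where "g x = (\<Sum>(m, is)\<in>G \<times> ?L. c m is * (\<phi> m x * (\<Prod>i\<leftarrow>is. x $ i - pt m $ i)))" for x
    have gT: "g x = (\<Sum>m\<in>G. \<phi> m x * T m x)" for x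
      by (simp add: g_def T_def sum.cartesian_product[symmetric] sum_distrib_left algebra_simps)
    have err: "\<bar>f x - g x\<bar> \<le> \<epsilon>" if x: "x \<in> cbox 0 1" for x
    proof -
      have xi: "0 \<le> x $ i" "x $ i \<le> 1" for i using x by (auto simp: mem_box_cart)
      \<comment> \<open>Expanding a product of one-dimensional partitions of unity gives the sum
        over the grid.\<close>
      have "(\<Sum>m\<in>G. \<phi> m x) = (\<Prod>i\<in>(UNIV :: 'd set). \<Sum>j\<le>N. hat (N * x $ i - real j))"
        unfolding G_def \<phi>_def by (subst prod_sum_PiE) auto
      also have "\<dots> = 1"
        using xi by (intro prod.neutral ballI sum_hat) (auto simp: mult_left_le)
      finally have one: "(\<Sum>m\<in>G. \<phi> m x) = 1" .
      have \<phi>0: "\<phi> m x \<ge> 0" for m by (auto simp: \<phi>_def intro!: prod_nonneg hat_nonneg)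
      \<comment> \<open>Since the \<open>\<phi> m x\<close> sum to one, the error is a weighted
        average of local Taylor errors; only grid points within \<open>1 / N\<close> of
        \<open>x\<close> in every coordinate have nonzero weight.\<close>
      have "H x - g x = (\<Sum>m\<in>G. \<phi> m x * (H x - T m x))"
        by (simp add: gT right_diff_distrib sum_subtractf sum_distrib_right[symmetric] one)
      also have "\<bar>\<dots>\<bar> \<le> (\<Sum>m\<in>G. \<phi> m x * (\<epsilon> / 2))"
      proof (rule order_trans[OF sum_abs], rule sum_mono)
        fix m assume m: "m \<in> G"
        show "\<bar>\<phi> m x * (H x - T m x)\<bar> \<le> \<phi> m x * (\<epsilon> / 2)"
        proof (cases "\<phi> m x = 0")
          case False
          have near: "\<bar>x $ i - pt m $ i\<bar> \<le> 1 / N" for i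
          proof -
            have "\<bar>N * x $ i - real (m i)\<bar> \<le> 1"
              by (rule hat_supp) (use False in \<open>auto simp: \<phi>_def\<close>)
            then show ?thesis using N0 by (simp add: pt_def field_simps abs_le_iff)
          qed
          have "\<bar>H x - T m x\<bar> \<le> \<epsilon> / 2"
            unfolding T_def by (rule order_trans[OF c[rule_format, OF m x near] Nerr])
          from mult_left_mono[OF this \<phi>0[of m]] show ?thesis
            using \<phi>0[of m] by (simp add: abs_mult)
        qed simp
      qed
      also have "\<dots> = \<epsilon> / 2" by (simp only: sum_distrib_right[symmetric] one mult_1)
      finally show ?thesis using H(1)[OF x] by linarith
    qed
    have R: "realizes ?acts (card (G \<times> ?L) * P) g"
      unfolding g_def
    proof (rule realizes_sum)
      show "finite (G \<times> ?L)" "G \<times> ?L \<noteq> {}" using G L by auto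
      fix p assume "p \<in> G \<times> ?L"
      then obtain m "is" where p: "p = (m, is)" "length is < n" by auto
      let ?gs = "map (\<lambda>i (x :: real ^ 'd). hat (N * x $ i - real (m i))) coords @ map (\<lambda>i x. x $ i - pt m $ i) is"
      have "realizes ?acts P (\<lambda>x. prod_list (map (\<lambda>g. g x) ?gs))"
      proof (rule P)
        show "length ?gs \<le> ?d + n" using p(2) by (simp add: length_coords)
        show "realizes [ReLU] 12 g" if "g \<in> set ?gs" for g
          using that by (auto intro: realizes_hat realizes_shift)
      qed
      moreover have "(\<lambda>x. prod_list (map (\<lambda>g. g x) ?gs)) = (\<lambda>x. \<phi> m x * (\<Prod>i\<leftarrow>is. x $ i - pt m $ i))"
      proof -
        have "(\<Prod>i\<leftarrow>coords. h i) = (\<Prod>i\<in>UNIV. h i)" for h :: "'d \<Rightarrow> real"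
          using prod.distinct_set_conv_list[OF coords(1), of h] by (simp add: coords(2))
        then show ?thesis by (simp add: \<phi>_def o_def)
      qed
      ultimately have "realizes ?acts P (\<lambda>x. \<phi> m x * (\<Prod>i\<leftarrow>is. x $ i - pt m $ i))"
        by (simp only:)
      from realizes_affine[OF this, of "c m is" 0]
      show "realizes ?acts P (\<lambda>x. case p of (m, is) \<Rightarrow> c m is * (\<phi> m x * (\<Prod>i\<leftarrow>is. x $ i - pt m $ i)))"
        by (simp add: p)
    qed
    obtain A and a :: "param \<Rightarrow> real" where A: "valid_architecture ?d A" "card (params A) \<le> card (G \<times> ?L) * P"
      "a \<in> params A \<rightarrow>\<^sub>E UNIV" "\<And>x. network A a x = g x"
      by (rule realizes_network[OF R]; rule that; assumption)
    have dr: "real ?d * q \<le> real ?d * (2 * r)" using q2 by (rule mult_left_mono) simp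
    have "real (N + 1) = real N + 1" by simp
    \<comment> \<open>The units lost to rounding up and to \<open>N + 1\<close> fit into
      \<open>2 * r\<close> because \<open>r \<ge> 1\<close>.\<close>
    also have "\<dots> \<le> real ?d * (2 * r) + 2 * r"
      using N2 r dr by linarith
    also have "\<dots> = (2 * real ?d + 2) * r" by (simp add: algebra_simps)
    finally have "real (N + 1) ^ ?d \<le> ((2 * real ?d + 2) * r) ^ ?d"
      by (rule power_mono) simp
    also have "\<dots> = (2 * real ?d + 2) ^ ?d * \<epsilon> powr (- (?d / n))"
    proof -
      have "r ^ ?d = r powr real ?d" using r by (intro powr_realpow[symmetric]) simp
      also have "\<dots> = \<epsilon> powr (- (?d / n))" by (simp add: r_def powr_powr)
      finally show ?thesis by (simp only: power_mult_distrib)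
    qed
    finally have N3: "real (N + 1) ^ ?d \<le> (2 * real ?d + 2) ^ ?d * \<epsilon> powr (- (?d / n))" .
    have "card (params A) \<le> (N + 1) ^ ?d * (card ?L * Suc P)"
      using A(2) by (rule order_trans) (simp add: G card_cartesian_product)
    then have "real (card (params A)) \<le> real ((N + 1) ^ ?d * (card ?L * Suc P))"
      by (simp only: of_nat_le_iff)
    also have "\<dots> = real (N + 1) ^ ?d * real (card ?L * Suc P)"
      by (simp only: of_nat_mult of_nat_power)
    also have "\<dots> \<le> ((2 * real ?d + 2) ^ ?d * \<epsilon> powr (- (?d / n))) * real (card ?L * Suc P)"
      using N3 by (rule mult_right_mono) simp
    also have "\<dots> = C * \<epsilon> powr (- (?d / n))"
      by (simp only: C_def mult_ac)
    finally have size: "real (card (params A)) \<le> C * \<epsilon> powr (- (?d / n))" .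
    show "\<exists>A. valid_architecture CARD('d) A \<and>
             real (card (params A)) \<le> C * \<epsilon> powr (- (real CARD('d) / real n)) \<and>
             (\<exists>a \<in> params A \<rightarrow>\<^sub>E (UNIV :: real set).
                \<forall>x \<in> cbox 0 1. \<bar>f x - network A a x\<bar> \<le> \<epsilon>)"
    proof (intro exI[of _ A] conjI bexI[of _ a] ballI)
      show "\<bar>f x - network A a x\<bar> \<le> \<epsilon>" if "x \<in> cbox 0 1" for x
        unfolding A(4) using that by (rule err)
    qed (fact A(1) size A(3))+
  qed
qed

end
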